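(* Let $K$ be a commutative ring with $\mathbb Q\subset K$, and let $\mathfrak g=\bigoplus_{k\in K}\mathfrak g_k$ be a Lie $K$-algebra that is $K$-graded as a Lie $K$-algebra. Suppose that the $K$-submodule $W\subset\bigotimes\mathfrak g$ is closed, for every $r$ and every $\sigma_r\in\Sigma_r$, under the action of $\sigma_r$ permuting the tensor factors in the $r$th tensor order, and that $W$ is also closed under selecting homogeneous components of elements of $\bigotimes\mathfrak g$ position-wise in the tensor products. Also assume that $\boldsymbol m|_W:W\to\mathcal U\mathfrak g$ is injective. If \[P=\sum_{n,\lambda}a_{1,\lambda}\otimes\cdots\otimes a_{n,\lambda}\] (a finite sum of tensors of various orders $n\ge1$) is such that $P\in W$ and $\boldsymbol m(P)\in\mathfrak g$, then \[\boldsymbol m(w(P))=\sum_{n,\lambda}[a_{1,\lambda},\ldots,a_{n-1,\lambda},w(a_{n,\lambda})]_{\mathrm L}.\]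
   Context: $K$-graded means $\mathfrak g=\bigoplus_{k\in K}\mathfrak g_k$ as $K$-modules with $[\mathfrak g_k,\mathfrak g_l]\subset\mathfrak g_{k+l}$. The tensor algebra $\bigotimes\mathfrak g$ inherits the $K$-grading in which $\mathfrak g_{k_1}\otimes\cdots\otimes\mathfrak g_{k_r}$ has grade $k_1+\cdots+k_r$. The map $w:\bigotimes\mathfrak g\to\bigotimes\mathfrak g$ is multiplication by $k$ on the component of grade $k\in K$; in particular it acts on $\mathfrak g=\bigotimes^1\mathfrak g$. Selecting homogeneous components position-wise means applying the projections of $\bigotimes\mathfrak g$ onto the direct summands $\mathfrak g_{k_1}\otimes\cdots\otimes\mathfrak g_{k_r}$. $\mathcal U\mathfrak g$ is the universal enveloping algebra and $\boldsymbol m:\bigotimes\mathfrak g\to\mathcal U\mathfrak g$ is the canonical algebra homomorphism $x_1\otimes\cdots\otimes x_n\mapsto x_1\cdots x_n$. Since $\mathbb Q\subset K$, by the Poincaré–Birkhoff–Witt theorem $\mathfrak g$ is regarded as a subset of $\mathcal U\mathfrak g$. Left-iterated commutators: $[Y_1,\ldots,Y_p]_{\mathrm L}=[Y_1,[Y_2,\ldots,[Y_{p-1},Y_p]\ldots]]$, with $[Y_1]_{\mathrm L}=Y_1$. *)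

theory Defs
  imports
    "HOL-Algebra.Module"
    "HOL-Algebra.QuotRing"
    "HOL-Algebra.Algebraic_Closure_Type"
    "HOL-Combinatorics.Permutations"
    "HOL-Library.Poly_Mapping"
begin

section \<open>Direct sum decompositions of modules\<close>

definition submodule_span ::
    "('k, 'a) ring_scheme \<Rightarrow> ('k, 'm, 'b) module_scheme \<Rightarrow> 'm set \<Rightarrow> 'm set" where
  "submodule_span R M S = \<Inter>{H. submodule H R M \<and> S \<subseteq> H}"

definition decomposition ::
    "('k, 'm, 'b) module_scheme \<Rightarrow> ('i \<Rightarrow> 'm set) \<Rightarrow> 'm \<Rightarrow> ('i \<Rightarrow> 'm) \<Rightarrow> bool" where
  "decomposition M D x f \<longleftrightarrow>
     (\<forall>i. f i \<in> D i) \<and> finite {i. f i \<noteq> \<zero>\<^bsub>M\<^esub>} \<and> x = (\<Oplus>\<^bsub>M\<^esub>i\<in>{i. f i \<noteq> \<zero>\<^bsub>M\<^esub>}. f i)"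

definition direct_sum ::
    "('k, 'a) ring_scheme \<Rightarrow> ('k, 'm, 'b) module_scheme \<Rightarrow> ('i \<Rightarrow> 'm set) \<Rightarrow> bool" where
  "direct_sum R M D \<longleftrightarrow>
     (\<forall>i. submodule (D i) R M) \<and> (\<forall>x\<in>carrier M. \<exists>!f. decomposition M D x f)"

text \<open>The projection onto the summand \<open>D i\<close>; only meaningful if \<open>M\<close> is the direct sum of the
  family \<open>D\<close>.\<close>

definition component ::
    "('k, 'm, 'b) module_scheme \<Rightarrow> ('i \<Rightarrow> 'm set) \<Rightarrow> 'i \<Rightarrow> 'm \<Rightarrow> 'm" where
  "component M D i x = (THE f. decomposition M D x f) i"

text \<open>For a module graded by its own ring of scalars: multiplication by \<open>k\<close> on the component of
  grade \<open>k\<close>.\<close>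

definition grade_mult ::
    "('k, 'm, 'b) module_scheme \<Rightarrow> ('k \<Rightarrow> 'm set) \<Rightarrow> 'm \<Rightarrow> 'm" where
  "grade_mult M D x =
     (\<Oplus>\<^bsub>M\<^esub>k\<in>{k. component M D k x \<noteq> \<zero>\<^bsub>M\<^esub>}. k \<odot>\<^bsub>M\<^esub> component M D k x)"


section \<open>Graded Lie algebras\<close>

text \<open>The scalars and the Lie algebra are given by types. The following turns the module into a
  record; its multiplicative part is irrelevant and left unspecified.\<close>

definition module_of ::
    "('k::comm_ring_1 \<Rightarrow> 'g::ab_group_add \<Rightarrow> 'g) \<Rightarrow> ('k, 'g) module" where
  "module_of scale =
     \<lparr>carrier = UNIV, monoid.mult = undefined, one = undefined,
      ring.zero = 0, add = (+), module.smult = scale\<rparr>"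

locale lie_algebra = Modules.module scale
  for scale :: "'k::comm_ring_1 \<Rightarrow> 'g::ab_group_add \<Rightarrow> 'g" +
  fixes lie :: "'g \<Rightarrow> 'g \<Rightarrow> 'g"
  assumes lie_add_left: "lie (x + y) z = lie x z + lie y z"
    and lie_add_right: "lie x (y + z) = lie x y + lie x z"
    and lie_scale_left: "lie (scale c x) y = scale c (lie x y)"
    and lie_scale_right: "lie x (scale c y) = scale c (lie x y)"
    and lie_self: "lie x x = 0"
    and jacobi: "lie x (lie y z) + lie y (lie z x) + lie z (lie x y) = 0"

locale graded_lie_algebra = lie_algebra scale lie
  for scale :: "'k::comm_ring_1 \<Rightarrow> 'g::ab_group_add \<Rightarrow> 'g" and lie +
  fixes G :: "'k \<Rightarrow> 'g set"
  assumes grading: "direct_sum (ring_of_type_algebra :: 'k ring) (module_of scale) G"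
    and lie_grading: "x \<in> G k \<Longrightarrow> y \<in> G l \<Longrightarrow> lie x y \<in> G (k + l)"

text \<open>\<open>left_comm lie [y\<^sub>1, \<dots>, y\<^sub>p]\<close> is \<open>lie y\<^sub>1 (lie y\<^sub>2 (\<dots> (lie y\<^sub>q y\<^sub>p)))\<close>, \<open>q = p - 1\<close>;
  the value on the empty list is a dummy.\<close>

fun left_comm :: "('g::zero \<Rightarrow> 'g \<Rightarrow> 'g) \<Rightarrow> 'g list \<Rightarrow> 'g" where
  "left_comm lie [] = 0"
| "left_comm lie [y] = y"
| "left_comm lie (y # z # ys) = lie y (left_comm lie (z # ys))"


section \<open>The tensor algebra\<close>

text \<open>Words over \<open>'g\<close> form a monoid under concatenation (written additively), so that the
  finitely supported functions on them with convolution form the free associative algebra on the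
  set \<open>'g\<close>.\<close>

datatype 'g free_word = Word (letters: "'g list")

instantiation free_word :: (type) monoid_add
begin

definition zero_free_word :: "'a free_word" where
  "0 = Word []"

definition plus_free_word :: "'a free_word \<Rightarrow> 'a free_word \<Rightarrow> 'a free_word" where
  "u + v = Word (letters u @ letters v)"

instance
  by standard (simp_all add: zero_free_word_def plus_free_word_def)

end

type_synonym ('g, 'k) free_algebra = "'g free_word \<Rightarrow>\<^sub>0 'k"

type_synonym ('g, 'k) tensor = "('g, 'k) free_algebra set"

abbreviation free_ring :: "('g, 'k::comm_ring_1) free_algebra ring" where
  "free_ring \<equiv> ring_of_type_algebra"

definition var :: "'g \<Rightarrow> ('g, 'k::comm_ring_1) free_algebra" where
  "var x = Poly_Mapping.single (Word [x]) 1"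

definition const :: "'k \<Rightarrow> ('g, 'k::comm_ring_1) free_algebra" where
  "const c = Poly_Mapping.single 0 c"

text \<open>The tensor algebra of the module is the quotient of the free associative algebra on the
  underlying set of the module by the two-sided ideal which makes \<open>var\<close> linear.\<close>

definition tensor_ideal ::
    "('k::comm_ring_1 \<Rightarrow> 'g::ab_group_add \<Rightarrow> 'g) \<Rightarrow> ('g, 'k) free_algebra set" where
  "tensor_ideal scale = genideal free_ring
     ({var (x + y) - (var x + var y) | x y. True} \<union>
      {var (scale c x) - const c * var x | c x. True})"

definition tensor_algebra ::
    "('k::comm_ring_1 \<Rightarrow> 'g::ab_group_add \<Rightarrow> 'g) \<Rightarrow> ('k, ('g, 'k) tensor) module" where
  "tensor_algebra scale =
     (let J = tensor_ideal scale; Q = free_ring Quot J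
      in \<lparr>carrier = carrier Q, monoid.mult = monoid.mult Q, one = one Q,
          ring.zero = ring.zero Q, add = add Q,
          module.smult = (\<lambda>c t. (J +>\<^bsub>free_ring\<^esub> const c) \<otimes>\<^bsub>Q\<^esub> t)\<rparr>)"

text \<open>\<open>pure_tensor scale [x\<^sub>1, \<dots>, x\<^sub>r]\<close> is \<open>x\<^sub>1 \<otimes> \<dots> \<otimes> x\<^sub>r\<close>.\<close>

definition pure_tensor ::
    "('k::comm_ring_1 \<Rightarrow> 'g::ab_group_add \<Rightarrow> 'g) \<Rightarrow> 'g list \<Rightarrow> ('g, 'k) tensor" where
  "pure_tensor scale xs =
     tensor_ideal scale +>\<^bsub>free_ring\<^esub> Poly_Mapping.single (Word xs) 1"

text \<open>The direct summand \<open>G k\<^sub>1 \<otimes> \<dots> \<otimes> G k\<^sub>r\<close> of the tensor algebra, indexed by the list of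
  the \<open>k\<^sub>i\<close>; for the empty list these are the scalars.\<close>

definition tensor_summand ::
    "('k::comm_ring_1 \<Rightarrow> 'g::ab_group_add \<Rightarrow> 'g) \<Rightarrow> ('k \<Rightarrow> 'g set) \<Rightarrow> 'k list \<Rightarrow> ('g, 'k) tensor set"
  where
  "tensor_summand scale G ks = submodule_span ring_of_type_algebra (tensor_algebra scale)
     (pure_tensor scale ` {xs. list_all2 (\<lambda>k x. x \<in> G k) ks xs})"

definition tensor_grade ::
    "('k::comm_ring_1 \<Rightarrow> 'g::ab_group_add \<Rightarrow> 'g) \<Rightarrow> ('k \<Rightarrow> 'g set) \<Rightarrow> 'k \<Rightarrow> ('g, 'k) tensor set"
  where
  "tensor_grade scale G k = submodule_span ring_of_type_algebra (tensor_algebra scale)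
     (\<Union>ks\<in>{ks. sum_list ks = k}. tensor_summand scale G ks)"

text \<open>The operator \<open>w\<close>, on the tensor algebra and on the Lie algebra (tensors of order one).\<close>

definition tensor_w ::
    "('k::comm_ring_1 \<Rightarrow> 'g::ab_group_add \<Rightarrow> 'g) \<Rightarrow> ('k \<Rightarrow> 'g set) \<Rightarrow> ('g, 'k) tensor \<Rightarrow> ('g, 'k) tensor"
  where
  "tensor_w scale G = grade_mult (tensor_algebra scale) (tensor_grade scale G)"

definition lie_w ::
    "('k::comm_ring_1 \<Rightarrow> 'g::ab_group_add \<Rightarrow> 'g) \<Rightarrow> ('k \<Rightarrow> 'g set) \<Rightarrow> 'g \<Rightarrow> 'g" where
  "lie_w scale G = grade_mult (module_of scale) G"

text \<open>A permutation \<open>\<sigma>\<close> of \<open>{..<r}\<close> permutes the factors of the tensors of order \<open>r\<close> and fixes the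
  tensors of all other orders. The linear extension to the free algebra respects the ideal and
  hence acts on cosets. (This is the right action \<open>x\<^sub>1 \<otimes> \<dots> \<otimes> x\<^sub>r \<mapsto> x\<^sub>\<sigma>\<^sub>1 \<otimes> \<dots> \<otimes> x\<^sub>\<sigma>\<^sub>r\<close>; it differs from the left
  action only by inverting \<open>\<sigma>\<close>.)\<close>

definition free_permute ::
    "nat \<Rightarrow> (nat \<Rightarrow> nat) \<Rightarrow> ('g, 'k::comm_ring_1) free_algebra \<Rightarrow> ('g, 'k) free_algebra" where
  "free_permute r \<sigma> f =
     (\<Sum>u\<in>Poly_Mapping.keys f.
        Poly_Mapping.single
          (if length (letters u) = r then Word (permute_list \<sigma> (letters u)) else u)
          (Poly_Mapping.lookup f u))"

definition tensor_permute ::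
    "('k::comm_ring_1 \<Rightarrow> 'g::ab_group_add \<Rightarrow> 'g) \<Rightarrow> nat \<Rightarrow> (nat \<Rightarrow> nat) \<Rightarrow>
      ('g, 'k) tensor \<Rightarrow> ('g, 'k) tensor" where
  "tensor_permute scale r \<sigma> t =
     (\<Union>f\<in>t. tensor_ideal scale +>\<^bsub>free_ring\<^esub> free_permute r \<sigma> f)"


section \<open>The universal enveloping algebra\<close>

definition envelope_ideal ::
    "('k::comm_ring_1 \<Rightarrow> 'g::ab_group_add \<Rightarrow> 'g) \<Rightarrow> ('g \<Rightarrow> 'g \<Rightarrow> 'g) \<Rightarrow> ('g, 'k) tensor set" where
  "envelope_ideal scale lie = genideal (tensor_algebra scale)
     {pure_tensor scale [x, y] \<ominus>\<^bsub>tensor_algebra scale\<^esub> pure_tensor scale [y, x]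
        \<ominus>\<^bsub>tensor_algebra scale\<^esub> pure_tensor scale [lie x y] | x y. True}"

definition envelope ::
    "('k::comm_ring_1 \<Rightarrow> 'g::ab_group_add \<Rightarrow> 'g) \<Rightarrow> ('g \<Rightarrow> 'g \<Rightarrow> 'g) \<Rightarrow> ('g, 'k) tensor set ring" where
  "envelope scale lie = tensor_algebra scale Quot envelope_ideal scale lie"

text \<open>The canonical algebra homomorphism from the tensor algebra is the quotient map.\<close>

definition envelope_map ::
    "('k::comm_ring_1 \<Rightarrow> 'g::ab_group_add \<Rightarrow> 'g) \<Rightarrow> ('g \<Rightarrow> 'g \<Rightarrow> 'g) \<Rightarrow>
      ('g, 'k) tensor \<Rightarrow> ('g, 'k) tensor set" where
  "envelope_map scale lie t = envelope_ideal scale lie +>\<^bsub>tensor_algebra scale\<^esub> t"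

definition lie_embedding ::
    "('k::comm_ring_1 \<Rightarrow> 'g::ab_group_add \<Rightarrow> 'g) \<Rightarrow> ('g \<Rightarrow> 'g \<Rightarrow> 'g) \<Rightarrow> 'g \<Rightarrow> ('g, 'k) tensor set" where
  "lie_embedding scale lie x = envelope_map scale lie (pure_tensor scale [x])"

end

theory Submission
  imports Defs "HOL-Library.Product_Plus"
begin

text \<open>If \<open>m P = m x\<close> with \<open>x\<close> in the Lie algebra, both sides equal \<open>w x\<close>. On the left, \<open>w\<close> preserves
  the kernel of \<open>m\<close>, because that ideal is generated by homogeneous elements. On the right, \<open>w\<close> is a
  derivation of the Lie algebra, so \<open>x \<cdot> (c, y) = (0, c w x + [x, y])\<close> is a representation on
  \<open>'k \<times> 'g\<close>, which factors through the enveloping algebra; a product \<open>x\<^sub>1 \<dots> x\<^sub>n\<close> with \<open>n \<ge> 1\<close> maps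
  \<open>(1, 0)\<close> to \<open>(0, [x\<^sub>1, \<dots>, x\<^sub>q, w x\<^sub>n]\<^sub>L)\<close>, \<open>q = n - 1\<close>.\<close>

section \<open>Finitely supported functions and two-sided ideals\<close>

text \<open>The formula singles out the last letter of each word, so the adjoint representation
  alone does not show that it respects the relations of the enveloping algebra. One extra dimension
  repairs this: a letter sends (1, 0) to its image under \<open>w\<close> and acts on the pairs (0,
  y) by the bracket, and the derivation rule is exactly what makes these two kinds of action satisfy
  the commutator relation together.

  The other obstacle is that tensors are cosets in the free algebra on the bare set
  \<open>'g\<close>, where neither the addition of letters nor their grading is visible. A word with
  inhomogeneous letters must be expanded, and the expansion is compatible with linearity only modulo
  the tensor ideal. The grading is therefore studied on representatives, by congruences: a
  homomorphism into a monoid algebra with exponents in \<open>'k\<close> splits a representative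
  into components, and an ideal is stable under this splitting as soon as the components of its
  generators lie in it.\<close>

definition extend :: "('a \<Rightarrow> 'b::ab_group_add \<Rightarrow> 'c::ab_group_add) \<Rightarrow> ('a \<Rightarrow>\<^sub>0 'b) \<Rightarrow> 'c" where
  "extend h p = (\<Sum>k\<in>Poly_Mapping.keys p. h k (Poly_Mapping.lookup p k))"

text \<open>Additivity forces \<open>h k 0 = 0\<close>, so keys that cancel in a sum do no harm.
  Nothing else is asked of \<open>h\<close>, which lets one construction serve for
  \<open>graded\<close>, \<open>total\<close>, \<open>free_w\<close> and
  \<open>free_action\<close>.\<close>

lemma additive_extend:
  assumes "\<And>k. additive (h k)"
  shows "additive (extend h)"
proof
  fix p q
  show "extend h (p + q) = extend h p + extend h q"
    unfolding extend_def
    by (intro setsum_keys_plus_distrib) (auto simp: additive.zero[OF assms] additive.add[OF assms])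
qed

lemma extend_single:
  assumes "\<And>k. additive (h k)"
  shows "extend h (Poly_Mapping.single k x) = h k x"
  by (simp add: extend_def additive.zero[OF assms])

lemma extend_single_eq_self: "extend Poly_Mapping.single p = p"
proof -
  have "Poly_Mapping.lookup (extend Poly_Mapping.single p) k = Poly_Mapping.lookup p k" for k
    by (cases "k \<in> Poly_Mapping.keys p")
      (auto simp: extend_def Poly_Mapping.lookup_sum lookup_single when_def in_keys_iff)
  then show ?thesis
    by (simp add: poly_mapping_eqI)
qed

lemma poly_mapping_single_induct [case_names zero single add]:
  fixes p :: "'a \<Rightarrow>\<^sub>0 'b::ab_group_add"
  assumes "P 0"
    and "\<And>k x. P (Poly_Mapping.single k x)"
    and "\<And>p q. P p \<Longrightarrow> P q \<Longrightarrow> P (p + q)"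
  shows "P p"
proof -
  have "P (\<Sum>k\<in>A. Poly_Mapping.single k (Poly_Mapping.lookup p k))" if "finite A" for A
    using that assms by (induction A) auto
  from this[OF finite_keys[of p]] show ?thesis
    using extend_single_eq_self[of p] by (simp add: extend_def)
qed

lemma mult_eq_sum_single:
  fixes p q :: "'a::monoid_add \<Rightarrow>\<^sub>0 'b::ring_1"
  shows "p * q = (\<Sum>k\<in>Poly_Mapping.keys p. \<Sum>l\<in>Poly_Mapping.keys q.
           Poly_Mapping.single (k + l) (Poly_Mapping.lookup p k * Poly_Mapping.lookup q l))"
proof -
  have "p * q = extend Poly_Mapping.single p * extend Poly_Mapping.single q"
    by (simp add: extend_single_eq_self)
  then show ?thesis
    by (simp add: extend_def sum_product mult_single)
qed

text \<open>The exponent 0 commutes with every exponent, so only the centrality of \<open>z\<close>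
  remains. The coefficients may be noncommutative because later they are themselves elements of the
  free algebra.\<close>

lemma single_zero_central:
  fixes z :: "'b::ring_1" and p :: "'a::monoid_add \<Rightarrow>\<^sub>0 'b"
  assumes "\<And>x. z * x = x * z"
  shows "Poly_Mapping.single 0 z * p = p * Poly_Mapping.single 0 z"
  by (induction p rule: poly_mapping_single_induct) (simp_all add: mult_single assms algebra_simps)

lemma const_central: "const c * f = f * const c"
  unfolding const_def by (rule single_zero_central) (simp add: mult.commute)

lemma const_mult_single: "const c * Poly_Mapping.single u d = Poly_Mapping.single u (c * d)"
  by (simp add: const_def mult_single)

lemma lookup_single_zero_mult:
  fixes z :: "'b::ring_1" and p :: "'a::monoid_add \<Rightarrow>\<^sub>0 'b"
  shows "Poly_Mapping.lookup (Poly_Mapping.single 0 z * p) k = z * Poly_Mapping.lookup p k"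
  by (induction p rule: poly_mapping_single_induct)
    (simp_all add: mult_single lookup_single when_def lookup_add algebra_simps)

section \<open>Two-sided ideals as congruences in type-class arithmetic\<close>

lemma ring_of_type_algebra_simps [simp]:
  "carrier ring_of_type_algebra = UNIV"
  "x \<otimes>\<^bsub>ring_of_type_algebra\<^esub> y = x * y"
  "\<one>\<^bsub>ring_of_type_algebra\<^esub> = 1"
  "\<zero>\<^bsub>ring_of_type_algebra\<^esub> = 0"
  "x \<oplus>\<^bsub>ring_of_type_algebra\<^esub> y = x + y"
  by (simp_all add: ring_of_type_algebra_def)

lemma ring_type: "ring (ring_of_type_algebra :: 'a::ring_1 ring)"
proof -
  have "\<exists>y. y + x = 0" for x :: 'a
    by (metis add.left_inverse)
  then show ?thesis
    by (intro ringI abelian_groupI monoidI) (auto simp: algebra_simps)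
qed

lemma a_inv_type [simp]: "\<ominus>\<^bsub>ring_of_type_algebra\<^esub> x = - (x :: 'a::ring_1)"
proof -
  interpret ring "ring_of_type_algebra :: 'a ring"
    by (rule ring_type)
  show ?thesis
    using minus_equality[of "- x" x] by simp
qed

lemma ideal_type_iff:
  fixes S :: "'a::ring_1 set"
  shows "ideal S ring_of_type_algebra \<longleftrightarrow>
    0 \<in> S \<and> (\<forall>x\<in>S. \<forall>y\<in>S. x + y \<in> S) \<and> (\<forall>x\<in>S. \<forall>y. y * x \<in> S \<and> x * y \<in> S)"
    (is "_ \<longleftrightarrow> ?R")
proof
  assume "ideal S ring_of_type_algebra"
  then interpret ideal S "ring_of_type_algebra :: 'a ring" .
  show ?R
    using additive_subgroup.zero_closed[OF is_additive_subgroup]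
      additive_subgroup.a_closed[OF is_additive_subgroup] I_l_closed I_r_closed by auto
next
  assume R: ?R
  interpret ring "ring_of_type_algebra :: 'a ring"
    by (rule ring_type)
  have "- x \<in> S" if "x \<in> S" for x
    using R that by (metis mult_minus1)
  with R show "ideal S ring_of_type_algebra"
    by (intro idealI ring_type add.subgroupI) (auto simp flip: a_inv_def)
qed

locale type_ideal =
  fixes S :: "'a::ring_1 set"
  assumes ideal: "ideal S ring_of_type_algebra"
begin

lemma zero: "0 \<in> S"
  and add: "x \<in> S \<Longrightarrow> y \<in> S \<Longrightarrow> x + y \<in> S"
  and mult_left: "x \<in> S \<Longrightarrow> y * x \<in> S"
  and mult_right: "x \<in> S \<Longrightarrow> x * y \<in> S"
  using ideal unfolding ideal_type_iff by auto

lemma minus: "x \<in> S \<Longrightarrow> - x \<in> S"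
  by (metis mult_left mult_minus1)

lemma diff: "x \<in> S \<Longrightarrow> y \<in> S \<Longrightarrow> x - y \<in> S"
  using add[of x "- y"] minus by simp

lemma sum: "(\<And>i. i \<in> A \<Longrightarrow> f i \<in> S) \<Longrightarrow> sum f A \<in> S"
  by (induction A rule: infinite_finite_induct) (auto intro: zero add)

lemma trans: "x - y \<in> S \<Longrightarrow> y - z \<in> S \<Longrightarrow> x - z \<in> S"
  using add[of "x - y" "y - z"] by simp

lemma cong: "x - y \<in> S \<Longrightarrow> x \<in> S \<longleftrightarrow> y \<in> S"
  using add[of "x - y" y] diff[of x "x - y"] by auto

lemma mult_cong: "x - x' \<in> S \<Longrightarrow> y - y' \<in> S \<Longrightarrow> x * y - x' * y' \<in> S"
  using add[OF mult_right[of "x - x'" y] mult_left[of "y - y'" x']] by (simp add: algebra_simps)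

end

lemma type_idealI:
  fixes S :: "'a::ring_1 set"
  assumes "0 \<in> S" "\<And>x y. x \<in> S \<Longrightarrow> y \<in> S \<Longrightarrow> x + y \<in> S"
    and "\<And>x y. x \<in> S \<Longrightarrow> y * x \<in> S" "\<And>x y. x \<in> S \<Longrightarrow> x * y \<in> S"
  shows "type_ideal S"
  using assms by (simp add: type_ideal_def ideal_type_iff)

text \<open>For an ideal \<open>S\<close> this is the kernel of reducing coefficients modulo
  \<open>S\<close>. It stands in for the monoid algebra over the quotient ring, so that
  representatives can be kept throughout.\<close>

definition coeffs_in :: "'b set \<Rightarrow> ('a \<Rightarrow>\<^sub>0 'b::zero) set" where
  "coeffs_in S = {p. \<forall>k. Poly_Mapping.lookup p k \<in> S}"

lemma type_ideal_coeffs_in: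
  fixes S :: "'b::ring_1 set"
  assumes "type_ideal S"
  shows "type_ideal (coeffs_in S :: ('a::monoid_add \<Rightarrow>\<^sub>0 'b) set)"
proof -
  interpret type_ideal S by fact
  show ?thesis
    by (rule type_idealI; auto simp: coeffs_in_def zero lookup_add add mult_eq_sum_single
        Poly_Mapping.lookup_sum lookup_single when_def intro!: sum)
      (blast intro: mult_left mult_right)+
qed

section \<open>The graded Lie algebra and its tensor algebra\<close>

lemma module_of_simps [simp]:
  "carrier (module_of scale) = UNIV"
  "\<zero>\<^bsub>module_of scale\<^esub> = 0"
  "x \<oplus>\<^bsub>module_of scale\<^esub> y = x + y"
  "c \<odot>\<^bsub>module_of scale\<^esub> x = scale c x"
  by (simp_all add: module_of_def)

lemma abelian_group_module_of: "abelian_group (module_of scale)"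
  by (rule abelian_groupI) (auto simp: algebra_simps intro: exI[of _ "- x" for x])

lemma finsum_module_of: "finite A \<Longrightarrow> finsum (module_of scale) f A = sum f A"
proof (induction A rule: finite_induct)
  interpret abelian_group "module_of scale"
    by (rule abelian_group_module_of)
  case empty
  show ?case
    using finsum_empty by simp
next
  interpret abelian_group "module_of scale"
    by (rule abelian_group_module_of)
  case (insert x A)
  then show ?case
    using finsum_insert[of A x f] by simp
qed

lemma sum_mono_zero:
  assumes "finite A" "\<And>k. f k \<noteq> 0 \<Longrightarrow> k \<in> A"
  shows "sum f {k. f k \<noteq> 0} = sum f A"
  using assms by (intro sum.mono_neutral_left) auto

context graded_lie_algebra
begin

definition grade_part :: "'k \<Rightarrow> 'g \<Rightarrow> 'g" where
  "grade_part k x = component (module_of scale) G k x"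

lemma decomposition_iff:
  "decomposition (module_of scale) G x f \<longleftrightarrow>
    (\<forall>k. f k \<in> G k) \<and> finite {k. f k \<noteq> 0} \<and> x = sum f {k. f k \<noteq> 0}"
  by (auto simp: decomposition_def finsum_module_of)

lemma ex1_decomposition: "\<exists>!f. decomposition (module_of scale) G x f"
  using grading by (simp add: direct_sum_def)

lemma decomposition_grade_part: "decomposition (module_of scale) G x (\<lambda>k. grade_part k x)"
  using theI'[OF ex1_decomposition] by (simp add: grade_part_def component_def)

lemma grade_part_mem: "grade_part k x \<in> G k"
  and finite_grade_part: "finite {k. grade_part k x \<noteq> 0}"
  and sum_grade_part: "(\<Sum>k | grade_part k x \<noteq> 0. grade_part k x) = x"
  using decomposition_grade_part[of x] by (auto simp: decomposition_iff)

lemma submodule_G: "submodule (G k) (ring_of_type_algebra :: 'k ring) (module_of scale)"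
  using grading by (simp add: direct_sum_def)

lemma G_zero: "0 \<in> G k"
  and G_add: "x \<in> G k \<Longrightarrow> y \<in> G k \<Longrightarrow> x + y \<in> G k"
  and G_scale: "x \<in> G k \<Longrightarrow> scale c x \<in> G k"
proof -
  interpret submodule "G k" "ring_of_type_algebra :: 'k ring" "module_of scale"
    by (rule submodule_G)
  show "0 \<in> G k" "x \<in> G k \<Longrightarrow> y \<in> G k \<Longrightarrow> x + y \<in> G k" "x \<in> G k \<Longrightarrow> scale c x \<in> G k"
    using one_closed m_closed smult_closed by auto
qed

text \<open>The finite set \<open>A\<close> may exceed the support of \<open>f\<close>, so that two
  elements can be decomposed over a common index set.\<close>

lemma grade_part_unique:
  assumes "\<And>k. f k \<in> G k" "finite A" "\<And>k. f k \<noteq> 0 \<Longrightarrow> k \<in> A" "x = sum f A"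
  shows "grade_part k x = f k"
proof -
  have "decomposition (module_of scale) G x f"
    using assms finite_subset[of "{k. f k \<noteq> 0}" A]
    by (auto simp: decomposition_iff sum_mono_zero)
  with ex1_decomposition decomposition_grade_part have "(\<lambda>k. grade_part k x) = f"
    by blast
  then show ?thesis
    by meson
qed

lemma grade_part_add: "grade_part k (x + y) = grade_part k x + grade_part k y"
proof (rule grade_part_unique)
  let ?A = "{k. grade_part k x \<noteq> 0} \<union> {k. grade_part k y \<noteq> 0}"
  show "finite ?A"
    by (simp add: finite_grade_part)
  show "x + y = (\<Sum>k\<in>?A. grade_part k x + grade_part k y)"
    using sum_mono_zero[of ?A "\<lambda>k. grade_part k x"] sum_mono_zero[of ?A "\<lambda>k. grade_part k y"]
    by (simp add: sum.distrib finite_grade_part sum_grade_part)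
qed (auto intro: G_add grade_part_mem)

lemma grade_part_scale: "grade_part k (scale c x) = scale c (grade_part k x)"
proof (rule grade_part_unique)
  show "scale c x = (\<Sum>k | grade_part k x \<noteq> 0. scale c (grade_part k x))"
    by (simp add: sum_grade_part flip: scale_sum_right)
qed (auto intro: G_scale grade_part_mem simp: finite_grade_part)

lemma grade_part_homogeneous: "x \<in> G k \<Longrightarrow> grade_part l x = (if l = k then x else 0)"
  by (rule grade_part_unique[where A = "{k}"]) (auto simp: G_zero split: if_splits)

lemma homogeneous_induct [case_names zero homogeneous add]:
  assumes "P 0" "\<And>k x. x \<in> G k \<Longrightarrow> P x" "\<And>x y. P x \<Longrightarrow> P y \<Longrightarrow> P (x + y)"
  shows "P x"
proof -
  have "P (\<Sum>k\<in>A. grade_part k x)" if "finite A" for A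
    using that by (induction A) (auto intro: assms grade_part_mem)
  from this[OF finite_grade_part[of x]] show ?thesis
    by (simp add: sum_grade_part)
qed

lemma lie_w_eq_sum: "finite A \<Longrightarrow> (\<And>k. grade_part k x \<noteq> 0 \<Longrightarrow> k \<in> A) \<Longrightarrow>
    lie_w scale G x = (\<Sum>k\<in>A. scale k (grade_part k x))"
  unfolding lie_w_def grade_mult_def grade_part_def[symmetric]
  by (subst finsum_module_of) (auto simp: finite_grade_part intro!: sum.mono_neutral_left)

lemma lie_w_add: "lie_w scale G (x + y) = lie_w scale G x + lie_w scale G y"
proof -
  let ?A = "{k. grade_part k x \<noteq> 0} \<union> {k. grade_part k y \<noteq> 0}"
  have "lie_w scale G z = (\<Sum>k\<in>?A. scale k (grade_part k z))" if "z \<in> {x, y, x + y}" for z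
    using that by (intro lie_w_eq_sum) (auto simp: finite_grade_part grade_part_add)
  then show ?thesis
    by (simp add: grade_part_add scale_right_distrib sum.distrib)
qed

lemma lie_w_scale: "lie_w scale G (scale c x) = scale c (lie_w scale G x)"
proof -
  have "lie_w scale G z = (\<Sum>k | grade_part k x \<noteq> 0. scale k (grade_part k z))" if "z \<in> {x, scale c x}" for z
    using that by (intro lie_w_eq_sum) (auto simp: finite_grade_part grade_part_scale)
  then show ?thesis
    by (simp add: grade_part_scale scale_sum_right mult.commute)
qed

lemma lie_w_homogeneous: "x \<in> G k \<Longrightarrow> lie_w scale G x = scale k x"
  by (subst lie_w_eq_sum[of "{k}"]) (auto simp: grade_part_homogeneous split: if_splits)

lemma lie_w_zero: "lie_w scale G 0 = 0"
  using lie_w_add[of 0 0] by simp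

lemma lie_zero_left: "lie 0 x = 0"
  and lie_zero_right: "lie x 0 = 0"
  using lie_add_left[of 0 0 x] lie_add_right[of x 0 0] by auto

lemma lie_swap: "lie x y = - lie y x"
proof -
  have "lie (x + y) (x + y) = lie x y + lie y x"
    unfolding lie_add_left lie_add_right by (simp add: lie_self)
  then show ?thesis
    by (simp add: lie_self eq_neg_iff_add_eq_0)
qed

text \<open>The Jacobi identity in the form needed for a representation: the adjoint map of a
  bracket is the commutator of the adjoint maps.\<close>

lemma lie_lie: "lie (lie x y) z = lie x (lie y z) - lie y (lie x z)"
proof -
  have "lie y (lie z x) = - lie y (lie x z)"
    using lie_swap[of z x] additive.minus[of "lie y" "lie x z"] by (simp add: additive_def lie_add_right)
  moreover have "lie (lie x y) z = lie x (lie y z) + lie y (lie z x)"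
    using jacobi[of x y z] lie_swap[of "lie x y" z] by (metis add_right_imp_eq add.left_inverse)
  ultimately show ?thesis
    by simp
qed

text \<open>For \<open>x\<close> of grade k and \<open>y\<close> of grade l the bracket has grade k
  + l, and the rule is the distributivity of the scalar k + l. Additivity in both arguments extends
  it to all elements.\<close>

lemma lie_w_lie: "lie_w scale G (lie x y) = lie (lie_w scale G x) y + lie x (lie_w scale G y)"
proof (induction x rule: homogeneous_induct)
  case (homogeneous k x)
  then show ?case
  proof (induction y rule: homogeneous_induct)
    case (homogeneous l y)
    then show ?case
      by (simp add: lie_w_homogeneous lie_w_homogeneous[OF lie_grading] lie_scale_left lie_scale_right scale_left_distrib)
  qed (simp_all add: lie_w_zero lie_w_add lie_zero_right lie_add_right algebra_simps)
qed (simp_all add: lie_w_zero lie_w_add lie_zero_left lie_add_left algebra_simps)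

end

section \<open>Tensors as cosets of elements of the free algebra\<close>

definition coset ::
    "('k::comm_ring_1 \<Rightarrow> 'g::ab_group_add \<Rightarrow> 'g) \<Rightarrow> ('g, 'k) free_algebra \<Rightarrow> ('g, 'k) tensor" where
  "coset scale f = tensor_ideal scale +>\<^bsub>free_ring\<^esub> f"

lemma tensor_ideal_ideal: "ideal (tensor_ideal scale) free_ring"
  unfolding tensor_ideal_def by (rule ring.genideal_ideal[OF ring_type]) simp

lemma type_ideal_tensor_ideal: "type_ideal (tensor_ideal scale)"
  by (simp add: type_ideal_def tensor_ideal_ideal)

lemma tensor_ideal_add: "var (x + y) - (var x + var y) \<in> tensor_ideal scale"
  and tensor_ideal_scale: "var (scale c x) - const c * var x \<in> tensor_ideal scale"
  unfolding tensor_ideal_def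
  by (rule subsetD[OF ring.genideal_self[OF ring_type]]; auto)+

lemma tensor_ideal_minimal:
  assumes "type_ideal S"
    and "\<And>x y. var (x + y) - (var x + var y) \<in> S"
    and "\<And>c x. var (scale c x) - const c * var x \<in> S"
  shows "tensor_ideal scale \<subseteq> S"
  unfolding tensor_ideal_def using assms
  by (intro ring.genideal_minimal[OF ring_type]) (auto simp: type_ideal_def)

lemma mem_coset_iff: "h \<in> coset scale f \<longleftrightarrow> h - f \<in> tensor_ideal scale"
proof -
  have "\<exists>j\<in>tensor_ideal scale. h = j + f" if "h - f \<in> tensor_ideal scale"
    using that by (intro bexI[of _ "h - f"]) auto
  then show ?thesis
    by (auto simp: coset_def a_r_coset_def')
qed

lemma coset_eq_iff: "coset scale f = coset scale g \<longleftrightarrow> f - g \<in> tensor_ideal scale"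
proof -
  interpret type_ideal "tensor_ideal scale"
    by (rule type_ideal_tensor_ideal)
  show ?thesis
  proof
    assume "coset scale f = coset scale g"
    then show "f - g \<in> tensor_ideal scale"
      using mem_coset_iff[of f scale f] mem_coset_iff[of f scale g] zero by simp
  next
    assume "f - g \<in> tensor_ideal scale"
    then have "h - f \<in> tensor_ideal scale \<longleftrightarrow> h - g \<in> tensor_ideal scale" for h
      using cong[of "h - g" "h - f"] by simp
    then show "coset scale f = coset scale g"
      by (simp add: set_eq_iff mem_coset_iff)
  qed
qed

lemma tensor_algebra_simps:
  "carrier (tensor_algebra scale) = range (coset scale)"
  "coset scale f \<oplus>\<^bsub>tensor_algebra scale\<^esub> coset scale g = coset scale (f + g)"
  "coset scale f \<otimes>\<^bsub>tensor_algebra scale\<^esub> coset scale g = coset scale (f * g)"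
  "\<one>\<^bsub>tensor_algebra scale\<^esub> = coset scale 1"
  "\<zero>\<^bsub>tensor_algebra scale\<^esub> = coset scale 0"
  "c \<odot>\<^bsub>tensor_algebra scale\<^esub> coset scale f = coset scale (const c * f)"
proof -
  interpret ideal "tensor_ideal scale" free_ring
    by (rule tensor_ideal_ideal)
  show "carrier (tensor_algebra scale) = range (coset scale)"
    by (auto simp: tensor_algebra_def FactRing_def A_RCOSETS_def' coset_def Let_def)
  show "coset scale f \<oplus>\<^bsub>tensor_algebra scale\<^esub> coset scale g = coset scale (f + g)"
    using a_rcos_sum[of f g] by (simp add: tensor_algebra_def FactRing_def coset_def Let_def)
  show "coset scale f \<otimes>\<^bsub>tensor_algebra scale\<^esub> coset scale g = coset scale (f * g)"
    by (simp add: tensor_algebra_def FactRing_def coset_def Let_def rcoset_mult_add[simplified])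
  show "\<one>\<^bsub>tensor_algebra scale\<^esub> = coset scale 1"
    by (simp add: tensor_algebra_def FactRing_def coset_def Let_def)
  show "\<zero>\<^bsub>tensor_algebra scale\<^esub> = coset scale 0"
    by (simp add: tensor_algebra_def FactRing_def coset_def Let_def a_r_coset_def')
  show "c \<odot>\<^bsub>tensor_algebra scale\<^esub> coset scale f = coset scale (const c * f)"
    by (simp add: tensor_algebra_def FactRing_def coset_def Let_def rcoset_mult_add[simplified])
qed

lemma ring_tensor_algebra: "ring (tensor_algebra scale)"
proof (intro ringI abelian_groupI monoidI)
  fix t
  assume "t \<in> carrier (tensor_algebra scale)"
  then obtain f where "t = coset scale f"
    by (auto simp: tensor_algebra_simps)
  then show "\<exists>s\<in>carrier (tensor_algebra scale). s \<oplus>\<^bsub>tensor_algebra scale\<^esub> t = \<zero>\<^bsub>tensor_algebra scale\<^esub>"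
    by (auto simp: tensor_algebra_simps intro!: exI[of _ "- f"])
qed (auto simp: tensor_algebra_simps algebra_simps)

lemma tensor_algebra_minus:
  "coset scale f \<ominus>\<^bsub>tensor_algebra scale\<^esub> coset scale g = coset scale (f - g)"
  and tensor_algebra_a_inv: "\<ominus>\<^bsub>tensor_algebra scale\<^esub> coset scale g = coset scale (- g)"
proof -
  interpret ring "tensor_algebra scale"
    by (rule ring_tensor_algebra)
  show *: "\<ominus>\<^bsub>tensor_algebra scale\<^esub> coset scale g = coset scale (- g)"
    by (rule minus_equality) (auto simp: tensor_algebra_simps)
  show "coset scale f \<ominus>\<^bsub>tensor_algebra scale\<^esub> coset scale g = coset scale (f - g)"
    by (simp add: a_minus_def * tensor_algebra_simps)
qed

lemma finsum_tensor_algebra: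
  "finite A \<Longrightarrow> (\<Oplus>\<^bsub>tensor_algebra scale\<^esub>i\<in>A. coset scale (f i)) = coset scale (sum f A)"
proof (induction A rule: finite_induct)
  interpret ring "tensor_algebra scale"
    by (rule ring_tensor_algebra)
  case empty
  show ?case
    by (simp add: tensor_algebra_simps)
next
  interpret ring "tensor_algebra scale"
    by (rule ring_tensor_algebra)
  case (insert x A)
  then show ?case
    by (subst finsum_insert) (auto simp: tensor_algebra_simps)
qed

lemma submodule_tensor_algebra_iff:
  "submodule H (ring_of_type_algebra :: 'k::comm_ring_1 ring) (tensor_algebra scale) \<longleftrightarrow>
    H \<subseteq> range (coset scale) \<and> coset scale 0 \<in> H \<and>
    (\<forall>f g. coset scale f \<in> H \<longrightarrow> coset scale g \<in> H \<longrightarrow> coset scale (f + g) \<in> H) \<and>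
    (\<forall>c f. coset scale f \<in> H \<longrightarrow> coset scale (const c * f) \<in> H)" (is "_ \<longleftrightarrow> ?R")
proof
  assume "submodule H (ring_of_type_algebra :: 'k ring) (tensor_algebra scale)"
  then interpret submodule H "ring_of_type_algebra :: 'k ring" "tensor_algebra scale" .
  have "H \<subseteq> range (coset scale)" "coset scale 0 \<in> H"
    using subset one_closed by (simp_all add: tensor_algebra_simps)
  moreover have "coset scale (f + g) \<in> H" if "coset scale f \<in> H" "coset scale g \<in> H" for f g
    using m_closed[OF that] by (simp add: tensor_algebra_simps)
  moreover have "coset scale (const c * f) \<in> H" if "coset scale f \<in> H" for c f
    using smult_closed[of c "coset scale f"] that by (simp add: tensor_algebra_simps)
  ultimately show ?R
    by simp
next
  assume R: ?R
  interpret ring "tensor_algebra scale"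
    by (rule ring_tensor_algebra)
  have "coset scale (- f) \<in> H" if "coset scale f \<in> H" for f
  proof -
    have "coset scale (const (- 1) * f) \<in> H"
      using R that by blast
    moreover have "const (- 1) * f = - f"
      unfolding const_def single_uminus by simp
    ultimately show ?thesis
      by simp
  qed
  note minus = this
  show "submodule H (ring_of_type_algebra :: 'k ring) (tensor_algebra scale)"
  proof (intro submodule.intro add.subgroupI submodule_axioms.intro)
    fix t s
    assume "t \<in> H" "s \<in> H"
    moreover from this R have "t \<in> range (coset scale)" "s \<in> range (coset scale)"
      by auto
    then obtain f g where "t = coset scale f" "s = coset scale g"
      by auto
    ultimately show "t \<oplus>\<^bsub>tensor_algebra scale\<^esub> s \<in> H" "\<ominus>\<^bsub>tensor_algebra scale\<^esub> t \<in> H"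
      "c \<odot>\<^bsub>tensor_algebra scale\<^esub> t \<in> H" for c
      using R minus by (simp_all add: tensor_algebra_simps tensor_algebra_a_inv)
  qed (use R in \<open>auto simp: tensor_algebra_simps\<close>)
qed

section \<open>The grading of the tensor algebra\<close>

context graded_lie_algebra
begin

sublocale J: type_ideal "tensor_ideal scale"
  by (rule type_ideal_tensor_ideal)

sublocale JK: type_ideal "coeffs_in (tensor_ideal scale) :: ('k \<Rightarrow>\<^sub>0 ('g, 'k) free_algebra) set"
  by (rule type_ideal_coeffs_in) (rule type_ideal_tensor_ideal)

lemma var_zero_mem: "var 0 \<in> tensor_ideal scale"
  using tensor_ideal_scale[of scale 0 0] by (simp add: const_def)

lemma var_sum: "var (\<Sum>i\<in>A. f i) - (\<Sum>i\<in>A. var (f i)) \<in> tensor_ideal scale"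
proof (induction A rule: infinite_finite_induct)
  case (insert i A)
  then show ?case
    using J.add[OF tensor_ideal_add[of "f i" "\<Sum>i\<in>A. f i" scale] insert.IH] by (simp add: algebra_simps)
qed (simp_all add: var_zero_mem)

definition graded_var :: "'g \<Rightarrow> 'k \<Rightarrow>\<^sub>0 ('g, 'k) free_algebra" where
  "graded_var x = (\<Sum>k | grade_part k x \<noteq> 0. Poly_Mapping.single k (var (grade_part k x)))"

lemma lookup_graded_var:
  "Poly_Mapping.lookup (graded_var x) k = (if grade_part k x = 0 then 0 else var (grade_part k x))"
  by (simp add: graded_var_def Poly_Mapping.lookup_sum lookup_single when_def finite_grade_part)

text \<open>Only a congruence: off the support the coefficient is 0, whereas \<open>var 0\<close> is
  a nonzero element of the free algebra that lies in the tensor ideal.\<close>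

lemma lookup_graded_var_cong: "Poly_Mapping.lookup (graded_var x) k - var (grade_part k x) \<in> tensor_ideal scale"
  by (simp add: lookup_graded_var J.zero J.minus var_zero_mem)

text \<open>The monoid algebra over the additive monoid \<open>'k\<close> with coefficients in the free algebra
  carries the grading: \<open>graded\<close> is the algebra homomorphism into it with
  \<open>x \<mapsto> \<Sum>k. x\<^sub>k e\<^sup>k\<close>, and modulo the tensor ideal its coefficient at \<open>k\<close> is the component of
  grade \<open>k\<close>. Its compatibility with that ideal makes the decomposition of tensors unique.\<close>

definition graded :: "('g, 'k) free_algebra \<Rightarrow> 'k \<Rightarrow>\<^sub>0 ('g, 'k) free_algebra" where
  "graded = extend (\<lambda>u c. Poly_Mapping.single 0 (const c) * prod_list (map graded_var (letters u)))"

lemma additive_graded_word: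
  "additive (\<lambda>c. Poly_Mapping.single 0 (const c) * prod_list (map graded_var (letters u)))"
  by standard (simp add: const_def single_add algebra_simps)

interpretation graded: additive graded
  unfolding graded_def by (rule additive_extend) (rule additive_graded_word)

lemma graded_single:
  "graded (Poly_Mapping.single u c) = Poly_Mapping.single 0 (const c) * prod_list (map graded_var (letters u))"
  unfolding graded_def by (rule extend_single) (rule additive_graded_word)

lemma graded_mult: "graded (f * g) = graded f * graded g"
proof (induction f rule: poly_mapping_single_induct)
  case (single u c)
  show ?case
  proof (induction g rule: poly_mapping_single_induct)
    case (single v d)
    let ?S = "\<lambda>c. Poly_Mapping.single 0 (const c) :: 'k \<Rightarrow>\<^sub>0 ('g, 'k) free_algebra"
    let ?m = "\<lambda>u. prod_list (map graded_var (letters u))"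
    have "graded (Poly_Mapping.single u c * Poly_Mapping.single v d) = ?S (c * d) * (?m u * ?m v)"
      by (simp add: mult_single graded_single plus_free_word_def)
    also have "?S (c * d) = ?S c * ?S d"
      by (simp add: const_def mult_single)
    also have "?S c * ?S d * (?m u * ?m v) = ?S c * (?S d * ?m u) * ?m v"
      by (simp add: mult.assoc)
    also have "?S d * ?m u = ?m u * ?S d"
      by (rule single_zero_central) (rule const_central)
    finally show ?case
      by (simp add: graded_single mult.assoc)
  qed (simp_all add: graded.zero graded.add algebra_simps)
qed (simp_all add: graded.zero graded.add algebra_simps)

lemma graded_var_eq: "graded (var x) = graded_var x"
  by (simp add: var_def graded_single const_def)

lemma graded_const: "graded (const c) = Poly_Mapping.single 0 (const c)"
  unfolding const_def[of c] by (simp add: graded_single zero_free_word_def const_def)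

text \<open>The preimage of an ideal under the ring homomorphism \<open>graded\<close>. It reduces
  stability under taking components to a check on generators, both for the tensor ideal and for the
  kernel of \<open>m\<close>.\<close>

lemma type_ideal_graded_vimage:
  assumes "type_ideal S"
  shows "type_ideal {f. graded f \<in> coeffs_in S}"
proof -
  interpret S: type_ideal "coeffs_in S :: ('k \<Rightarrow>\<^sub>0 ('g, 'k) free_algebra) set"
    by (rule type_ideal_coeffs_in) fact
  show ?thesis
    by (rule type_idealI)
      (simp_all add: graded.zero graded.add graded_mult S.zero S.add S.mult_left S.mult_right)
qed

text \<open>Taking grade parts is linear. Hence, once each coefficient is exchanged for the letter
  of its grade part, the coefficient of a generator at k becomes the same kind of generator for the
  parts of grade k.\<close>

lemma graded_tensor_ideal: "f \<in> tensor_ideal scale \<Longrightarrow> graded f \<in> coeffs_in (tensor_ideal scale)"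
proof -
  let ?S = "{f. graded f \<in> coeffs_in (tensor_ideal scale)}"
  let ?l = "\<lambda>x k. Poly_Mapping.lookup (graded_var x) k"
  have "tensor_ideal scale \<subseteq> ?S"
  proof (rule tensor_ideal_minimal)
    show "type_ideal ?S"
      by (rule type_ideal_graded_vimage) (rule type_ideal_tensor_ideal)
    show "var (x + y) - (var x + var y) \<in> ?S" for x y
    proof -
      have "?l (x + y) k - (?l x k + ?l y k) \<in> tensor_ideal scale" for k
        using J.diff[OF J.add[OF lookup_graded_var_cong[of "x + y" k] tensor_ideal_add[of "grade_part k x" "grade_part k y"]]
            J.add[OF lookup_graded_var_cong[of x k] lookup_graded_var_cong[of y k]]]
        by (simp add: grade_part_add algebra_simps)
      then show ?thesis
        by (simp add: coeffs_in_def graded.diff graded.add graded_var_eq lookup_minus lookup_add)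
    qed
    show "var (scale c x) - const c * var x \<in> ?S" for c x
    proof -
      have "?l (scale c x) k - const c * ?l x k \<in> tensor_ideal scale" for k
        using J.diff[OF J.add[OF lookup_graded_var_cong[of "scale c x" k] tensor_ideal_scale[of scale c "grade_part k x"]]
            J.mult_left[OF lookup_graded_var_cong[of x k], of "const c"]]
        by (simp add: grade_part_scale algebra_simps)
      then show ?thesis
        by (simp add: coeffs_in_def graded.diff graded_mult graded_const graded_var_eq
            lookup_minus lookup_single_zero_mult)
    qed
  qed
  then show "f \<in> tensor_ideal scale \<Longrightarrow> graded f \<in> coeffs_in (tensor_ideal scale)"
    by blast
qed

text \<open>The list of grades is existential because the letter 0 lies in every \<open>G l\<close>:
  a word can be homogeneous of several grades at once, so these sets become independent only modulo
  the tensor ideal.\<close>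

definition homogeneous :: "'k \<Rightarrow> ('g, 'k) free_algebra set" where
  "homogeneous k = {f. \<forall>u\<in>Poly_Mapping.keys f.
     \<exists>ks. sum_list ks = k \<and> list_all2 (\<lambda>l x. x \<in> G l) ks (letters u)}"

lemma homogeneous_zero: "0 \<in> homogeneous k"
  by (simp add: homogeneous_def)

lemma homogeneous_add: "f \<in> homogeneous k \<Longrightarrow> g \<in> homogeneous k \<Longrightarrow> f + g \<in> homogeneous k"
  using keys_add[of f g] unfolding homogeneous_def by blast

lemma homogeneous_minus: "f \<in> homogeneous k \<Longrightarrow> - f \<in> homogeneous k"
  by (simp add: homogeneous_def)

lemma homogeneous_diff: "f \<in> homogeneous k \<Longrightarrow> g \<in> homogeneous k \<Longrightarrow> f - g \<in> homogeneous k"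
  using homogeneous_add[of f k "- g"] homogeneous_minus by simp

lemma homogeneous_sum: "(\<And>i. i \<in> A \<Longrightarrow> f i \<in> homogeneous k) \<Longrightarrow> sum f A \<in> homogeneous k"
  by (induction A rule: infinite_finite_induct) (auto intro: homogeneous_zero homogeneous_add)

lemma homogeneous_mult:
  assumes "f \<in> homogeneous k" "g \<in> homogeneous l"
  shows "f * g \<in> homogeneous (k + l)"
  unfolding homogeneous_def
proof safe
  fix u
  assume "u \<in> Poly_Mapping.keys (f * g)"
  then obtain v w where vw: "u = v + w" "v \<in> Poly_Mapping.keys f" "w \<in> Poly_Mapping.keys g"
    using keys_mult[of f g] by blast
  with assms obtain ks ls where
    "sum_list ks = k" "list_all2 (\<lambda>l x. x \<in> G l) ks (letters v)"
    "sum_list ls = l" "list_all2 (\<lambda>l x. x \<in> G l) ls (letters w)"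
    unfolding homogeneous_def by blast
  then show "\<exists>ks. sum_list ks = k + l \<and> list_all2 (\<lambda>l x. x \<in> G l) ks (letters u)"
    using vw(1) by (intro exI[of _ "ks @ ls"]) (auto simp: plus_free_word_def intro: list_all2_appendI)
qed

lemma homogeneous_word:
  "list_all2 (\<lambda>l x. x \<in> G l) ks xs \<Longrightarrow> Poly_Mapping.single (Word xs) c \<in> homogeneous (sum_list ks)"
  by (auto simp: homogeneous_def)

lemma homogeneous_var: "x \<in> G k \<Longrightarrow> var x \<in> homogeneous k"
  using homogeneous_word[of "[k]" "[x]"] by (simp add: var_def)

lemma homogeneous_const: "const c \<in> homogeneous 0"
  using homogeneous_word[of "[]" "[]"] by (simp add: const_def zero_free_word_def)

text \<open>The source of uniqueness of components: up to the ideal, a homogeneous representative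
  has itself as its only component. The congruence holds for single letters, passes to words by
  multiplying exponents and coefficients together, and then to linear combinations.\<close>

lemma graded_homogeneous:
  assumes "f \<in> homogeneous k"
  shows "graded f - Poly_Mapping.single k f \<in> coeffs_in (tensor_ideal scale)"
proof -
  have var: "graded_var x - Poly_Mapping.single k (var x) \<in> coeffs_in (tensor_ideal scale)"
    if "x \<in> G k" for k x
    using that J.zero J.minus[OF var_zero_mem]
    by (auto simp: coeffs_in_def lookup_minus lookup_graded_var lookup_single grade_part_homogeneous when_def)
  have word: "prod_list (map graded_var xs) - Poly_Mapping.single (sum_list ks) (Poly_Mapping.single (Word xs) 1)
      \<in> coeffs_in (tensor_ideal scale)" if "list_all2 (\<lambda>l x. x \<in> G l) ks xs" for ks xs
    using that
  proof (induction rule: list_all2_induct)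
    case Nil
    show ?case
      using JK.zero by (simp flip: zero_free_word_def)
  next
    case (Cons k ks x xs)
    show ?case
      using JK.mult_cong[OF var[OF Cons.hyps(1)] Cons.IH]
      by (simp add: mult_single var_def plus_free_word_def)
  qed
  have "graded (Poly_Mapping.single u c) - Poly_Mapping.single k (Poly_Mapping.single u c)
      \<in> coeffs_in (tensor_ideal scale)" if u: "u \<in> Poly_Mapping.keys f" for u c
  proof -
    obtain ks where ks: "sum_list ks = k" "list_all2 (\<lambda>l x. x \<in> G l) ks (letters u)"
      using assms u by (auto simp: homogeneous_def)
    from JK.mult_left[OF word[OF ks(2)], of "Poly_Mapping.single 0 (const c)"] ks(1) show ?thesis
      by (simp add: graded_single algebra_simps mult_single const_mult_single)
  qed
  then have "(\<Sum>u\<in>Poly_Mapping.keys f. graded (Poly_Mapping.single u (Poly_Mapping.lookup f u))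
      - Poly_Mapping.single k (Poly_Mapping.single u (Poly_Mapping.lookup f u)))
      \<in> coeffs_in (tensor_ideal scale)"
    by (intro JK.sum) auto
  also have "(\<Sum>u\<in>Poly_Mapping.keys f. graded (Poly_Mapping.single u (Poly_Mapping.lookup f u))
      - Poly_Mapping.single k (Poly_Mapping.single u (Poly_Mapping.lookup f u)))
      = graded (extend Poly_Mapping.single f) - Poly_Mapping.single k (extend Poly_Mapping.single f)"
  proof -
    interpret single: additive "Poly_Mapping.single k :: ('g, 'k) free_algebra \<Rightarrow> _"
      by standard (rule single_add)
    show ?thesis
      by (simp add: extend_def sum_subtractf graded.sum single.sum)
  qed
  finally show ?thesis
    by (simp add: extend_single_eq_self)
qed

lemma lookup_graded_mem_homogeneous: "Poly_Mapping.lookup (graded f) k \<in> homogeneous k"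
proof -
  \<comment> \<open>\<open>S\<close> is closed under products because the grades of homogeneous
    factors add just as the exponents do; it therefore suffices that the images of scalars and
    letters lie in it.\<close>
  define S where "S = {p. \<forall>k. Poly_Mapping.lookup p k \<in> homogeneous k}"
  have single: "Poly_Mapping.single k f \<in> S" if "f \<in> homogeneous k" for k f
    using that by (auto simp: S_def lookup_single when_def homogeneous_zero)
  have sum: "sum h A \<in> S" if "\<And>i. i \<in> A \<Longrightarrow> h i \<in> S" for h :: "'k \<Rightarrow> _" and A
    using that by (auto simp: S_def Poly_Mapping.lookup_sum intro!: homogeneous_sum)
  have mult: "p * q \<in> S" if "p \<in> S" "q \<in> S" for p q
    unfolding mult_eq_sum_single[of p q] using that
    by (intro sum single homogeneous_mult) (auto simp: S_def)
  have var: "graded_var x \<in> S" for x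
    unfolding graded_var_def by (intro sum single homogeneous_var grade_part_mem)
  have const: "Poly_Mapping.single 0 (const c) \<in> S" for c
    by (rule single) (rule homogeneous_const)
  have word: "prod_list (map graded_var xs) \<in> S" for xs
  proof (induction xs)
    case Nil
    show ?case
      using const[of 1] by (simp add: const_def)
  qed (simp add: mult var)
  have "graded f \<in> S"
    unfolding graded_def extend_def
    by (auto simp: S_def Poly_Mapping.lookup_sum intro!: homogeneous_sum)
      (use mult[OF const word] in \<open>auto simp: S_def\<close>)
  then show ?thesis
    by (simp add: S_def)
qed

text \<open>The specialization that sets every formal exponential to 1; it adds up the
  components.\<close>

definition total :: "('k \<Rightarrow>\<^sub>0 ('g, 'k) free_algebra) \<Rightarrow> ('g, 'k) free_algebra" where
  "total = extend (\<lambda>_ f. f)"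

lemma additive_id: "additive (\<lambda>x. x)"
  by standard simp

interpretation total: additive total
  unfolding total_def by (rule additive_extend) (rule additive_id)

lemma total_single: "total (Poly_Mapping.single k f) = f"
  unfolding total_def by (rule extend_single) (rule additive_id)

lemma total_mult: "total (p * q) = total p * total q"
proof (induction p rule: poly_mapping_single_induct)
  case (single k f)
  show ?case
    by (induction q rule: poly_mapping_single_induct)
      (simp_all add: total.zero total.add mult_single total_single algebra_simps)
qed (simp_all add: total.zero total.add algebra_simps)

text \<open>Only a congruence, since \<open>graded\<close> exchanges a letter for the separate
  letters of its components, whose sum is that letter modulo the tensor ideal. This yields the
  existence of decompositions.\<close>

lemma total_graded: "total (graded f) - f \<in> tensor_ideal scale"
proof (induction f rule: poly_mapping_single_induct)
  case (single u c)
  have var: "total (graded_var x) - var x \<in> tensor_ideal scale" for x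
    using J.minus[OF var_sum[of "\<lambda>k. grade_part k x" "{k. grade_part k x \<noteq> 0}"]]
    by (simp add: graded_var_def total.sum total_single sum_grade_part)
  have "total (prod_list (map graded_var xs)) - Poly_Mapping.single (Word xs) 1 \<in> tensor_ideal scale" for xs
  proof (induction xs)
    case Nil
    show ?case
      using J.zero total_single[of 0 1] by (simp flip: zero_free_word_def)
  next
    case (Cons x xs)
    show ?case
      using J.mult_cong[OF var[of x] Cons.IH] by (simp add: total_mult mult_single var_def plus_free_word_def)
  qed
  from J.mult_left[OF this[of "letters u"], of "const c"] show ?case
    by (simp add: graded_single total_mult total_single algebra_simps const_mult_single)
next
  case (add f g)
  then show ?case
    using J.add[OF add] by (simp add: graded.add total.add algebra_simps)
qed (simp add: graded.zero total.zero J.zero)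

section \<open>The tensor algebra as the direct sum of its graded parts\<close>

lemma pure_tensor_eq_coset: "pure_tensor scale xs = coset scale (Poly_Mapping.single (Word xs) 1)"
  by (simp add: pure_tensor_def coset_def)

lemma submodule_homogeneous:
  "submodule (coset scale ` homogeneous k) (ring_of_type_algebra :: 'k ring) (tensor_algebra scale)"
  unfolding submodule_tensor_algebra_iff
proof (intro conjI allI impI)
  show "coset scale 0 \<in> coset scale ` homogeneous k"
    by (rule imageI) (rule homogeneous_zero)
next
  fix f g
  assume "coset scale f \<in> coset scale ` homogeneous k" "coset scale g \<in> coset scale ` homogeneous k"
  then obtain f' g' where *: "f' \<in> homogeneous k" "coset scale f = coset scale f'"
    "g' \<in> homogeneous k" "coset scale g = coset scale g'"
    by auto
  then have "coset scale (f + g) = coset scale (f' + g')"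
    using tensor_algebra_simps(2)[of scale] by metis
  with * show "coset scale (f + g) \<in> coset scale ` homogeneous k"
    by (auto intro: homogeneous_add)
next
  fix c f
  assume "coset scale f \<in> coset scale ` homogeneous k"
  then obtain f' where *: "f' \<in> homogeneous k" "coset scale f = coset scale f'"
    by auto
  then have "coset scale (const c * f) = coset scale (const c * f')"
    using tensor_algebra_simps(6)[of scale c] by metis
  with * homogeneous_mult[OF homogeneous_const[of c], of f' k]
  show "coset scale (const c * f) \<in> coset scale ` homogeneous k"
    by auto
qed auto

text \<open>Provides homogeneous representatives for elements of the nested spans. One inclusion is
  minimality of spans; for the other, each word of a homogeneous representative is a pure tensor in
  the summand of its list of grades.\<close>

lemma tensor_grade_eq: "tensor_grade scale G k = coset scale ` homogeneous k"
proof
  have "tensor_summand scale G ks \<subseteq> coset scale ` homogeneous (sum_list ks)" for ks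
    unfolding tensor_summand_def submodule_span_def
    by (rule Inter_lower) (auto simp: submodule_homogeneous pure_tensor_eq_coset intro!: imageI homogeneous_word)
  then show "tensor_grade scale G k \<subseteq> coset scale ` homogeneous k"
    unfolding tensor_grade_def submodule_span_def
    by (intro Inter_lower) (auto simp: submodule_homogeneous)
next
  show "coset scale ` homogeneous k \<subseteq> tensor_grade scale G k"
  proof safe
    fix f
    assume f: "f \<in> homogeneous k"
    show "coset scale f \<in> tensor_grade scale G k"
      unfolding tensor_grade_def submodule_span_def
    proof safe
      fix H
      assume H: "submodule H (ring_of_type_algebra :: 'k ring) (tensor_algebra scale)"
        and sub: "\<Union> (tensor_summand scale G ` {ks. sum_list ks = k}) \<subseteq> H"
      have word: "coset scale (Poly_Mapping.single u c) \<in> H" if "u \<in> Poly_Mapping.keys f" for u c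
      proof -
        obtain ks where ks: "sum_list ks = k" "list_all2 (\<lambda>l x. x \<in> G l) ks (letters u)"
          using f \<open>u \<in> Poly_Mapping.keys f\<close> by (auto simp: homogeneous_def)
        have "pure_tensor scale (letters u) \<in> tensor_summand scale G ks"
          unfolding tensor_summand_def submodule_span_def using ks by auto
        then have "coset scale (Poly_Mapping.single u 1) \<in> H"
          using sub ks by (auto simp: pure_tensor_eq_coset)
        then have "coset scale (const c * Poly_Mapping.single u 1) \<in> H"
          using H by (simp add: submodule_tensor_algebra_iff)
        then show ?thesis
          by (simp add: const_mult_single)
      qed
      have "coset scale (\<Sum>u\<in>A. Poly_Mapping.single u (Poly_Mapping.lookup f u)) \<in> H"
        if "finite A" "A \<subseteq> Poly_Mapping.keys f" for A
        using that word H by (induction A rule: finite_induct) (auto simp: submodule_tensor_algebra_iff)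
      from this[of "Poly_Mapping.keys f"] show "coset scale f \<in> H"
        using extend_single_eq_self[of f] by (simp add: extend_def)
    qed
  qed
qed

lemma decomposition_tensor_algebra_iff:
  "decomposition (tensor_algebra scale) (tensor_grade scale G) (coset scale f) t \<longleftrightarrow>
    t = (\<lambda>k. coset scale (Poly_Mapping.lookup (graded f) k))"
proof
  let ?t = "\<lambda>k. coset scale (Poly_Mapping.lookup (graded f) k)"
  have "{k. ?t k \<noteq> coset scale 0} \<subseteq> Poly_Mapping.keys (graded f)"
    by (auto simp: in_keys_iff)
  moreover from this have fin: "finite {k. ?t k \<noteq> coset scale 0}"
    by (rule finite_subset) simp
  moreover have "coset scale f = coset scale (sum (Poly_Mapping.lookup (graded f)) {k. ?t k \<noteq> coset scale 0})"
  proof -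
    \<comment> \<open>A component can be nonzero in the free algebra and still vanish as a tensor;
      the sum of all such components lies in the ideal and may be dropped.\<close>
    have "sum (Poly_Mapping.lookup (graded f)) (Poly_Mapping.keys (graded f) - {k. ?t k \<noteq> coset scale 0})
        \<in> tensor_ideal scale"
      by (intro J.sum) (auto simp: coset_eq_iff)
    then have "total (graded f) - sum (Poly_Mapping.lookup (graded f)) {k. ?t k \<noteq> coset scale 0}
        \<in> tensor_ideal scale"
      using calculation by (simp add: total_def extend_def sum_diff)
    from J.trans[OF _ this, of f] J.minus[OF total_graded[of f]] show ?thesis
      by (simp add: coset_eq_iff)
  qed
  ultimately show "decomposition (tensor_algebra scale) (tensor_grade scale G) (coset scale f) t"
    if "t = ?t"
    unfolding that
    by (auto simp: decomposition_def tensor_grade_eq lookup_graded_mem_homogeneous tensor_algebra_simps(5)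
        finsum_tensor_algebra)
next
  assume dec: "decomposition (tensor_algebra scale) (tensor_grade scale G) (coset scale f) t"
  then have "\<forall>k. \<exists>g. g \<in> homogeneous k \<and> t k = coset scale g"
    by (auto simp: decomposition_def tensor_grade_eq)
  then obtain g where g: "\<And>k. g k \<in> homogeneous k" "\<And>k. t k = coset scale (g k)"
    by metis
  define A where "A = {k. t k \<noteq> coset scale 0}"
  have A: "finite A" "coset scale f = coset scale (sum g A)"
    using dec by (auto simp: decomposition_def A_def tensor_algebra_simps(5) g finsum_tensor_algebra)
  \<comment> \<open>Uniqueness: \<open>graded\<close> is applied to the congruence between
    \<open>f\<close> and the sum of the given components, and coefficients are then
    compared.\<close>
  have "graded f - graded (sum g A) \<in> coeffs_in (tensor_ideal scale)"
    using graded_tensor_ideal[of "f - sum g A"] A(2) by (simp add: coset_eq_iff graded.diff)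
  moreover have "graded (sum g A) - (\<Sum>k\<in>A. Poly_Mapping.single k (g k)) \<in> coeffs_in (tensor_ideal scale)"
    using JK.sum[of A "\<lambda>k. graded (g k) - Poly_Mapping.single k (g k)"] graded_homogeneous g(1)
    by (simp add: graded.sum sum_subtractf)
  ultimately have *: "graded f - (\<Sum>k\<in>A. Poly_Mapping.single k (g k)) \<in> coeffs_in (tensor_ideal scale)"
    by (rule JK.trans)
  have "t k = coset scale (Poly_Mapping.lookup (graded f) k)" for k
  proof -
    have "Poly_Mapping.lookup (graded f) k - (if k \<in> A then g k else 0) \<in> tensor_ideal scale"
      using * A(1) by (simp add: coeffs_in_def lookup_minus Poly_Mapping.lookup_sum lookup_single when_def)
    then have "coset scale (Poly_Mapping.lookup (graded f) k) = coset scale (if k \<in> A then g k else 0)"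
      by (simp add: coset_eq_iff)
    also have "\<dots> = t k"
      by (auto simp: A_def g(2))
    finally show ?thesis ..
  qed
  then show "t = (\<lambda>k. coset scale (Poly_Mapping.lookup (graded f) k))"
    by blast
qed

definition free_w :: "('g, 'k) free_algebra \<Rightarrow> ('g, 'k) free_algebra" where
  "free_w f = (\<Sum>k\<in>Poly_Mapping.keys (graded f). const k * Poly_Mapping.lookup (graded f) k)"

text \<open>The two sums range over different sets, the nonzero components as tensors and those in
  the free algebra; the surplus terms are multiples of elements of the tensor ideal.\<close>

lemma tensor_w_coset: "tensor_w scale G (coset scale f) = coset scale (free_w f)"
proof -
  let ?t = "\<lambda>k. coset scale (Poly_Mapping.lookup (graded f) k)"
  let ?h = "\<lambda>k. const k * Poly_Mapping.lookup (graded f) k"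
  let ?A = "{k. ?t k \<noteq> coset scale 0}"
  have component: "component (tensor_algebra scale) (tensor_grade scale G) k (coset scale f) = ?t k" for k
    by (simp add: component_def decomposition_tensor_algebra_iff)
  have A: "?A \<subseteq> Poly_Mapping.keys (graded f)"
    by (auto simp: in_keys_iff)
  then have "finite ?A"
    by (rule finite_subset) simp
  then have "tensor_w scale G (coset scale f) = coset scale (sum ?h ?A)"
    by (simp add: tensor_w_def grade_mult_def component tensor_algebra_simps(5,6) finsum_tensor_algebra)
  also have "\<dots> = coset scale (free_w f)"
  proof -
    have "sum ?h (Poly_Mapping.keys (graded f) - ?A) \<in> tensor_ideal scale"
      by (intro J.sum J.mult_left) (auto simp: coset_eq_iff)
    from J.minus[OF this] show ?thesis
      using A by (simp add: coset_eq_iff free_w_def sum_diff)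
  qed
  finally show ?thesis .
qed

interpretation free_w: additive free_w
proof
  fix f g
  interpret h: additive "\<lambda>f. const k * f :: ('g, 'k) free_algebra" for k :: 'k
    by standard (simp add: algebra_simps)
  have "additive (extend (\<lambda>k f. const k * f :: ('g, 'k) free_algebra))"
    by (rule additive_extend) (rule h.additive_axioms)
  from additive.add[OF this] show "free_w (f + g) = free_w f + free_w g"
    by (simp add: free_w_def extend_def graded.add)
qed

lemma free_w_diff: "free_w (f - g) = free_w f - free_w g"
  by (rule free_w.diff)

text \<open>\<open>free_w f\<close> is a sum of multiples of the components of \<open>f\<close>, so
  an ideal that contains all of these contains it too.\<close>

lemma free_w_mem:
  assumes "type_ideal S" "graded f \<in> coeffs_in S"
  shows "free_w f \<in> S"
proof -
  interpret type_ideal S by fact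
  show ?thesis
    using assms(2) by (auto simp: free_w_def coeffs_in_def intro!: sum mult_left)
qed

lemma free_w_var: "free_w (var x) - var (lie_w scale G x) \<in> tensor_ideal scale"
proof -
  let ?A = "{k. grade_part k x \<noteq> 0}"
  \<comment> \<open>Ensures that no nonzero grade part is lost from the keys, so that the keys of
    \<open>graded_var x\<close> are exactly the grades occurring in \<open>x\<close>.\<close>
  have var: "var y \<noteq> (0 :: ('g, 'k) free_algebra)" for y
    by (auto simp: var_def dest: arg_cong[where f = "\<lambda>p. Poly_Mapping.lookup p (Word [y])"])
  have "Poly_Mapping.keys (graded_var x) = ?A"
    by (auto simp: in_keys_iff lookup_graded_var var)
  then have "free_w (var x) = (\<Sum>k\<in>?A. const k * var (grade_part k x))"
    by (simp add: free_w_def graded_var_eq lookup_graded_var)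
  moreover have "(\<Sum>k\<in>?A. const k * var (grade_part k x) - var (scale k (grade_part k x))) \<in> tensor_ideal scale"
    using J.minus[OF tensor_ideal_scale] by (intro J.sum) auto
  moreover have "(\<Sum>k\<in>?A. var (scale k (grade_part k x))) - var (lie_w scale G x) \<in> tensor_ideal scale"
    using J.minus[OF var_sum[of "\<lambda>k. scale k (grade_part k x)" ?A]] by (simp add: lie_w_eq_sum[of ?A] finite_grade_part)
  ultimately show ?thesis
    using J.trans by (simp add: sum_subtractf)
qed

section \<open>The enveloping algebra\<close>

definition lie_relation :: "'g \<Rightarrow> 'g \<Rightarrow> ('g, 'k) free_algebra" where
  "lie_relation x y = var x * var y - var y * var x - var (lie x y)"

lemma single_two: "Poly_Mapping.single (Word [x, y]) 1 = var x * var y"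
  by (simp add: var_def mult_single plus_free_word_def)

lemma envelope_ideal_eq:
  "envelope_ideal scale lie =
    genideal (tensor_algebra scale) {coset scale (lie_relation x y) | x y. True}"
  by (simp add: envelope_ideal_def pure_tensor_eq_coset single_two tensor_algebra_minus
      lie_relation_def flip: var_def)

lemma envelope_ideal_ideal: "ideal (envelope_ideal scale lie) (tensor_algebra scale)"
  unfolding envelope_ideal_eq
  by (rule ring.genideal_ideal[OF ring_tensor_algebra]) (auto simp: tensor_algebra_simps)

text \<open>The kernel of the composite from the free algebra to the enveloping algebra, which
  merges the two successive quotients into one congruence.\<close>

definition envelope_kernel :: "('g, 'k) free_algebra set" where
  "envelope_kernel = {f. coset scale f \<in> envelope_ideal scale lie}"

lemma type_ideal_envelope_kernel: "type_ideal envelope_kernel"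
proof -
  interpret E: ideal "envelope_ideal scale lie" "tensor_algebra scale"
    by (rule envelope_ideal_ideal)
  show ?thesis
  proof (rule type_idealI)
    show "0 \<in> envelope_kernel"
      using additive_subgroup.zero_closed[OF E.is_additive_subgroup]
      by (simp add: envelope_kernel_def tensor_algebra_simps)
    show "f + g \<in> envelope_kernel" if "f \<in> envelope_kernel" "g \<in> envelope_kernel" for f g
      using that additive_subgroup.a_closed[OF E.is_additive_subgroup, of "coset scale f" "coset scale g"]
      by (simp add: envelope_kernel_def tensor_algebra_simps)
    show "g * f \<in> envelope_kernel" "f * g \<in> envelope_kernel" if "f \<in> envelope_kernel" for f g
      using that E.I_l_closed[of "coset scale f" "coset scale g"] E.I_r_closed[of "coset scale f" "coset scale g"]
      by (simp_all add: envelope_kernel_def tensor_algebra_simps)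
  qed
qed

sublocale L: type_ideal envelope_kernel
  by (rule type_ideal_envelope_kernel)

lemma tensor_ideal_subset_envelope_kernel: "tensor_ideal scale \<subseteq> envelope_kernel"
proof
  fix f
  assume "f \<in> tensor_ideal scale"
  then have "coset scale f = coset scale 0"
    by (simp add: coset_eq_iff)
  then show "f \<in> envelope_kernel"
    using L.zero by (simp add: envelope_kernel_def)
qed

lemma lie_relation_mem: "lie_relation x y \<in> envelope_kernel"
proof -
  have "{coset scale (lie_relation x y) | x y. True} \<subseteq> envelope_ideal scale lie"
    unfolding envelope_ideal_eq
    by (rule ring.genideal_self[OF ring_tensor_algebra]) (auto simp: tensor_algebra_simps)
  then show ?thesis
    by (auto simp: envelope_kernel_def)
qed

text \<open>Ideals of the tensor algebra correspond to ideals of the free algebra containing the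
  tensor ideal; this containment is what allows \<open>S\<close> to be recovered from its
  image.\<close>

lemma envelope_kernel_minimal:
  assumes S: "type_ideal S" "tensor_ideal scale \<subseteq> S" and rel: "\<And>x y. lie_relation x y \<in> S"
  shows "envelope_kernel \<subseteq> S"
proof -
  interpret S: type_ideal S by fact
  interpret T: ring "tensor_algebra scale"
    by (rule ring_tensor_algebra)
  have "ideal (coset scale ` S) (tensor_algebra scale)"
    by (intro idealI ring_tensor_algebra T.add.subgroupI)
      (use S.zero in \<open>auto simp: tensor_algebra_simps tensor_algebra_a_inv
        simp flip: a_inv_def intro: S.add S.minus S.mult_left S.mult_right\<close>)
  then have sub: "envelope_ideal scale lie \<subseteq> coset scale ` S"
    unfolding envelope_ideal_eq using rel
    by (intro ring.genideal_minimal[OF ring_tensor_algebra]) auto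
  show ?thesis
  proof
    fix f
    assume "f \<in> envelope_kernel"
    with sub have "coset scale f \<in> coset scale ` S"
      by (simp add: envelope_kernel_def subset_iff)
    then obtain g where g: "g \<in> S" "f - g \<in> tensor_ideal scale"
      unfolding image_iff coset_eq_iff by blast
    then show "f \<in> S"
      using S.cong[OF subsetD[OF S(2) g(2)]] by simp
  qed
qed

text \<open>Additivity modulo the tensor ideal allows the relations to be checked on homogeneous
  arguments only.\<close>

lemma lie_relation_add_left:
  "lie_relation (x + x') y - (lie_relation x y + lie_relation x' y) \<in> tensor_ideal scale"
proof -
  have "(var (x + x') - (var x + var x')) * var y - var y * (var (x + x') - (var x + var x'))
      - (var (lie x y + lie x' y) - (var (lie x y) + var (lie x' y))) \<in> tensor_ideal scale"
    by (intro J.diff J.mult_left J.mult_right tensor_ideal_add)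
  then show ?thesis
    by (simp add: lie_relation_def lie_add_left algebra_simps)
qed

lemma lie_relation_add_right:
  "lie_relation x (y + y') - (lie_relation x y + lie_relation x y') \<in> tensor_ideal scale"
proof -
  have "var x * (var (y + y') - (var y + var y')) - (var (y + y') - (var y + var y')) * var x
      - (var (lie x y + lie x y') - (var (lie x y) + var (lie x y'))) \<in> tensor_ideal scale"
    by (intro J.diff J.mult_left J.mult_right tensor_ideal_add)
  then show ?thesis
    by (simp add: lie_relation_def lie_add_right algebra_simps)
qed

lemma lie_relation_zero: "lie_relation 0 y \<in> tensor_ideal scale" "lie_relation x 0 \<in> tensor_ideal scale"
  using J.mult_left[OF var_zero_mem] J.mult_right[OF var_zero_mem]
  by (auto simp: lie_relation_def lie_zero_left lie_zero_right intro!: J.diff var_zero_mem)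

text \<open>The defining relations have arbitrary arguments and are not homogeneous as they stand.
  Biadditivity reduces them to arguments of grades k and l, where all three terms have grade k + l
  because the bracket respects the grading; such a relation is its own only component.\<close>

lemma graded_envelope_kernel: "f \<in> envelope_kernel \<Longrightarrow> graded f \<in> coeffs_in envelope_kernel"
proof -
  interpret LK: type_ideal "coeffs_in envelope_kernel :: ('k \<Rightarrow>\<^sub>0 ('g, 'k) free_algebra) set"
    by (rule type_ideal_coeffs_in) (rule type_ideal_envelope_kernel)
  have sub: "coeffs_in (tensor_ideal scale) \<subseteq> coeffs_in envelope_kernel"
    using tensor_ideal_subset_envelope_kernel by (auto simp: coeffs_in_def)
  let ?S = "{f. graded f \<in> coeffs_in envelope_kernel}"
  have JS: "tensor_ideal scale \<subseteq> ?S"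
    using graded_tensor_ideal sub by auto
  interpret S: type_ideal ?S
    by (rule type_ideal_graded_vimage) (rule type_ideal_envelope_kernel)
  have "lie_relation x y \<in> ?S" for x y
  proof (induction x rule: homogeneous_induct)
    case zero
    show ?case
      using lie_relation_zero JS by blast
  next
    case (add x x')
    from S.add[OF add] S.cong[OF subsetD[OF JS lie_relation_add_left]] show ?case
      by blast
  next
    case (homogeneous k x)
    show ?case
    proof (induction y rule: homogeneous_induct)
      case zero
      show ?case
        using lie_relation_zero JS by blast
    next
      case (add y y')
      from S.add[OF add] S.cong[OF subsetD[OF JS lie_relation_add_right]] show ?case
        by blast
    next
      case (homogeneous l y)
      have "lie_relation x y \<in> homogeneous (k + l)"
        unfolding lie_relation_def
        using homogeneous_mult[of "var x" k "var y" l] homogeneous_mult[of "var y" l "var x" k]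
          homogeneous_var homogeneous \<open>x \<in> G k\<close> lie_grading
        by (auto simp: add.commute intro!: homogeneous_diff)
      then have "graded (lie_relation x y) - Poly_Mapping.single (k + l) (lie_relation x y)
          \<in> coeffs_in envelope_kernel"
        using graded_homogeneous sub by blast
      moreover have "Poly_Mapping.single (k + l) (lie_relation x y) \<in> coeffs_in envelope_kernel"
        by (auto simp: coeffs_in_def lookup_single when_def lie_relation_mem L.zero)
      ultimately show ?case
        using LK.cong by blast
    qed
  qed
  then have "envelope_kernel \<subseteq> ?S"
    by (rule envelope_kernel_minimal[OF S.type_ideal_axioms JS])
  then show "f \<in> envelope_kernel \<Longrightarrow> graded f \<in> coeffs_in envelope_kernel"
    by blast
qed

text \<open>The extension of the adjoint representation by the cocycle \<open>w\<close>.\<close>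

definition action :: "'g \<Rightarrow> 'k \<times> 'g \<Rightarrow> 'k \<times> 'g" where
  "action x v = (0, scale (fst v) (lie_w scale G x) + lie x (snd v))"

definition pair_scale :: "'k \<Rightarrow> 'k \<times> 'g \<Rightarrow> 'k \<times> 'g" where
  "pair_scale c v = (c * fst v, scale c (snd v))"

text \<open>The rightmost letter acts first, so it is the last factor of a tensor that meets the
  starting vector.\<close>

definition free_action :: "('g, 'k) free_algebra \<Rightarrow> 'k \<times> 'g \<Rightarrow> 'k \<times> 'g" where
  "free_action f v = extend (\<lambda>u c. pair_scale c (foldr action (letters u) v)) f"

lemma action_add: "action x (v + v') = action x v + action x v'"
  by (simp add: action_def lie_add_right scale_left_distrib algebra_simps)

lemma action_pair_scale: "action x (pair_scale c v) = pair_scale c (action x v)"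
  by (simp add: action_def pair_scale_def lie_scale_right scale_right_distrib)

lemma foldr_action_add: "foldr action xs (v + v') = foldr action xs v + foldr action xs v'"
  by (induction xs) (simp_all add: action_add)

lemma foldr_action_pair_scale: "foldr action xs (pair_scale c v) = pair_scale c (foldr action xs v)"
  by (induction xs) (simp_all add: action_pair_scale)

lemma pair_scale_add: "pair_scale c (v + v') = pair_scale c v + pair_scale c v'"
  and pair_scale_add_left: "pair_scale (c + d) v = pair_scale c v + pair_scale d v"
  and pair_scale_pair_scale: "pair_scale c (pair_scale d v) = pair_scale (c * d) v"
  and pair_scale_one: "pair_scale 1 v = v"
  by (simp_all add: pair_scale_def algebra_simps)

lemma additive_pair_scale: "additive (\<lambda>c. pair_scale c v)"
  by standard (rule pair_scale_add_left)

lemma additive_free_action: "additive (\<lambda>f. free_action f v)"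
  unfolding free_action_def by (rule additive_extend) (rule additive_pair_scale)

interpretation free_action: additive "\<lambda>f. free_action f v" for v
  by (rule additive_free_action)

lemma free_action_single: "free_action (Poly_Mapping.single u c) v = pair_scale c (foldr action (letters u) v)"
  unfolding free_action_def by (rule extend_single) (rule additive_pair_scale)

lemma free_action_add_right: "free_action f (v + v') = free_action f v + free_action f v'"
  by (simp add: free_action_def extend_def foldr_action_add pair_scale_add sum.distrib)

lemma free_action_zero_right: "free_action f 0 = 0"
  using free_action_add_right[of f 0 0] by simp

lemma free_action_mult: "free_action (f * g) v = free_action f (free_action g v)"
proof (induction f rule: poly_mapping_single_induct)
  case (single u c)
  show ?case
    by (induction g rule: poly_mapping_single_induct)
      (simp_all add: free_action.zero free_action.add free_action_zero_right free_action_add_right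
        mult_single free_action_single plus_free_word_def foldr_action_pair_scale
        pair_scale_pair_scale algebra_simps)
qed (simp_all add: free_action.zero free_action.add algebra_simps)

lemma free_action_var: "free_action (var x) v = action x v"
  by (simp add: var_def free_action_single pair_scale_one)

lemma free_action_const: "free_action (const c) v = pair_scale c v"
  by (simp add: const_def free_action_single zero_free_word_def)

lemma free_action_envelope_kernel: "f \<in> envelope_kernel \<Longrightarrow> free_action f v = 0"
proof -
  \<comment> \<open>Vanishing on all vectors makes this a two-sided ideal; the annihilator of a
    single vector is in general only a left ideal.\<close>
  let ?S = "{f. \<forall>v. free_action f v = 0}"
  have ideal: "type_ideal ?S"
    by (rule type_idealI)
      (simp_all add: free_action.zero free_action.add free_action_mult free_action_zero_right
        del: split_paired_All)
  have "envelope_kernel \<subseteq> ?S"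
  proof (rule envelope_kernel_minimal[OF ideal])
    show "tensor_ideal scale \<subseteq> ?S"
    proof (rule tensor_ideal_minimal[OF ideal])
      show "var (x + y) - (var x + var y) \<in> ?S" for x y
        by (simp add: free_action.diff free_action.add free_action_var action_def lie_w_add lie_add_left
            algebra_simps)
      show "var (scale c x) - const c * var x \<in> ?S" for c x
        by (simp add: free_action.diff free_action_mult free_action_const free_action_var action_def
            pair_scale_def lie_w_scale lie_scale_left algebra_simps zero_prod_def)
    qed
    \<comment> \<open>The terms in \<open>fst v\<close> cancel by the derivation rule for
      \<open>w\<close>, those in \<open>snd v\<close> by the Jacobi identity.\<close>
    have "action x (action y v) - action y (action x v) - action (lie x y) v = 0" for x y v
      by (simp add: action_def lie_w_lie lie_lie lie_add_right lie_scale_right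
          lie_swap[of y "lie_w scale G x"] algebra_simps zero_prod_def)
    then show "lie_relation x y \<in> ?S" for x y
      by (simp add: lie_relation_def free_action.diff free_action_mult free_action_var)
  qed
  then show "f \<in> envelope_kernel \<Longrightarrow> free_action f v = 0"
    by blast
qed

text \<open>The last letter turns (1, 0) into a pair with first entry 0, after which every earlier
  letter acts by its bracket alone.\<close>

lemma foldr_action_left_comm:
  "xs \<noteq> [] \<Longrightarrow> foldr action xs (1, 0) = (0, left_comm lie (butlast xs @ [lie_w scale G (last xs)]))"
proof (induction xs rule: list_nonempty_induct)
  case (single x)
  show ?case
    by (simp add: action_def lie_zero_right)
next
  case (cons x xs)
  then show ?case
    \<comment> \<open>\<open>left_comm\<close> unfolds only when the tail is visibly a cons; whether
      its head is an old letter or the image under \<open>w\<close> depends on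
      \<open>butlast xs\<close>.\<close>
    by (cases "butlast xs") (simp_all add: action_def)
qed

section \<open>Equality in the enveloping algebra as congruence of representatives\<close>

lemma envelope_map_coset_eq:
  assumes "f - g \<in> envelope_kernel"
  shows "envelope_map scale lie (coset scale f) = envelope_map scale lie (coset scale g)"
proof -
  interpret E: ideal "envelope_ideal scale lie" "tensor_algebra scale"
    by (rule envelope_ideal_ideal)
  have "coset scale f = coset scale (f - g) \<oplus>\<^bsub>tensor_algebra scale\<^esub> coset scale g"
    by (simp add: tensor_algebra_simps)
  then have "coset scale f \<in> envelope_map scale lie (coset scale g)"
    using assms by (auto simp: envelope_map_def envelope_kernel_def a_r_coset_def')
  then show ?thesis
    unfolding envelope_map_def
    by (intro E.a_repr_independence[symmetric] E.a_subgroup) (auto simp: tensor_algebra_simps)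
qed

lemma envelope_map_coset_eqD:
  assumes "envelope_map scale lie (coset scale f) = envelope_map scale lie (coset scale g)"
  shows "f - g \<in> envelope_kernel"
proof -
  interpret E: ideal "envelope_ideal scale lie" "tensor_algebra scale"
    by (rule envelope_ideal_ideal)
  have "coset scale f \<in> envelope_map scale lie (coset scale g)"
    using E.a_rcos_self[of "coset scale f"] assms by (simp add: envelope_map_def tensor_algebra_simps)
  then obtain t where t: "t \<in> envelope_ideal scale lie" "coset scale f = t \<oplus>\<^bsub>tensor_algebra scale\<^esub> coset scale g"
    by (auto simp: envelope_map_def a_r_coset_def')
  then have "t \<in> range (coset scale)"
    using E.a_Hcarr[of t] by (simp add: tensor_algebra_simps)
  then obtain h where h: "t = coset scale h"
    by auto
  with t have "(f - g) - h \<in> tensor_ideal scale"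
    by (simp add: tensor_algebra_simps coset_eq_iff algebra_simps)
  moreover have "h \<in> envelope_kernel"
    using t h by (simp add: envelope_kernel_def)
  ultimately show ?thesis
    using tensor_ideal_subset_envelope_kernel L.cong by blast
qed

lemma lie_embedding_eq: "lie_embedding scale lie x = envelope_map scale lie (coset scale (var x))"
  by (simp add: lie_embedding_def pure_tensor_eq_coset var_def)

text \<open>Collapses the right-hand side of the theorem to one embedded element, so that the
  comparison can take place inside the Lie algebra.\<close>

lemma finsum_lie_embedding:
  assumes "finite A"
  shows "(\<Oplus>\<^bsub>envelope scale lie\<^esub>i\<in>A. lie_embedding scale lie (f i)) = lie_embedding scale lie (sum f A)"
proof -
  interpret E: ideal "envelope_ideal scale lie" "tensor_algebra scale"
    by (rule envelope_ideal_ideal)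
  interpret hom: ring_hom_ring "tensor_algebra scale" "envelope scale lie" "envelope_map scale lie"
    using E.rcos_ring_hom_ring by (simp add: envelope_def envelope_map_def[abs_def])
  have "(\<Oplus>\<^bsub>envelope scale lie\<^esub>i\<in>A. lie_embedding scale lie (f i))
      = envelope_map scale lie (\<Oplus>\<^bsub>tensor_algebra scale\<^esub>i\<in>A. coset scale (var (f i)))"
    by (subst hom.hom_finsum) (auto simp: lie_embedding_eq[abs_def] tensor_algebra_simps o_def)
  also have "\<dots> = envelope_map scale lie (coset scale (\<Sum>i\<in>A. var (f i)))"
    using assms by (simp add: finsum_tensor_algebra)
  also have "\<dots> = lie_embedding scale lie (sum f A)"
    unfolding lie_embedding_eq
    using J.minus[OF var_sum[of f A]] tensor_ideal_subset_envelope_kernel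
    by (intro envelope_map_coset_eq) auto
  finally show ?thesis .
qed

lemma envelope_map_tensor_w:
  assumes "finite I" and nonempty: "\<And>i. i \<in> I \<Longrightarrow> a i \<noteq> []"
    and P: "P = (\<Oplus>\<^bsub>tensor_algebra scale\<^esub>i\<in>I. pure_tensor scale (a i))"
    and P_in_lie: "envelope_map scale lie P \<in> range (lie_embedding scale lie)"
  shows "envelope_map scale lie (tensor_w scale G P) =
    (\<Oplus>\<^bsub>envelope scale lie\<^esub>i\<in>I.
       lie_embedding scale lie (left_comm lie (butlast (a i) @ [lie_w scale G (last (a i))])))"
proof -
  define f :: "('g, 'k) free_algebra" where "f = (\<Sum>i\<in>I. Poly_Mapping.single (Word (a i)) 1)"
  have P_eq: "P = coset scale f"
    using \<open>finite I\<close> by (simp add: P f_def pure_tensor_eq_coset finsum_tensor_algebra)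
  then obtain x where "envelope_map scale lie (coset scale f) = envelope_map scale lie (coset scale (var x))"
    using P_in_lie by (auto simp: lie_embedding_eq)
  then have fx: "f - var x \<in> envelope_kernel"
    by (rule envelope_map_coset_eqD)
  have "free_w (f - var x) \<in> envelope_kernel"
    by (rule free_w_mem[OF type_ideal_envelope_kernel graded_envelope_kernel[OF fx]])
  then have "free_w f - free_w (var x) \<in> envelope_kernel"
    by (simp add: free_w_diff)
  moreover have "free_w (var x) - var (lie_w scale G x) \<in> envelope_kernel"
    using free_w_var tensor_ideal_subset_envelope_kernel by blast
  ultimately have "free_w f - var (lie_w scale G x) \<in> envelope_kernel"
    by (rule L.trans)
  then have "envelope_map scale lie (tensor_w scale G P) = lie_embedding scale lie (lie_w scale G x)"
    unfolding P_eq tensor_w_coset lie_embedding_eq by (rule envelope_map_coset_eq)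
  also have "lie_w scale G x = (\<Sum>i\<in>I. left_comm lie (butlast (a i) @ [lie_w scale G (last (a i))]))"
  proof -
    \<comment> \<open>Congruent representatives act alike. On (1, 0) the letter \<open>x\<close>
      gives \<open>w\<close> of \<open>x\<close>, while each word gives its iterated commutator; an
      empty word would instead leave (1, 0) unchanged, hence the appeal to
      \<open>nonempty\<close>.\<close>
    have "free_action f (1, 0) = free_action (var x) (1, 0)"
      using free_action_envelope_kernel[OF fx, of "(1, 0)"] by (simp add: free_action.diff)
    moreover have "free_action f (1, 0) = (\<Sum>i\<in>I. (0, left_comm lie (butlast (a i) @ [lie_w scale G (last (a i))])))"
      unfolding f_def free_action.sum
      by (intro sum.cong refl) (simp add: free_action_single pair_scale_one foldr_action_left_comm nonempty)
    moreover have "snd (free_action (var x) (1, 0)) = lie_w scale G x"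
      by (simp add: free_action_var action_def lie_zero_right)
    ultimately show ?thesis
      by (metis (no_types, lifting) snd_conv snd_sum sum.cong)
  qed
  finally show ?thesis
    using \<open>finite I\<close> by (simp add: finsum_lie_embedding)
qed

end

theorem proposition3p2:
  fixes scale :: "'k::comm_ring_1 \<Rightarrow> 'g::ab_group_add \<Rightarrow> 'g"
    and lie :: "'g \<Rightarrow> 'g \<Rightarrow> 'g"
    and G :: "'k \<Rightarrow> 'g set"
    and W :: "('g, 'k) tensor set"
    and I :: "'i set"
    and a :: "'i \<Rightarrow> 'g list"
    and P :: "('g, 'k) tensor"
  assumes rat_subring: "\<exists>\<rho>. \<rho> \<in> ring_hom (ring_of_type_algebra :: rat ring)
                                    (ring_of_type_algebra :: 'k ring) \<and> inj \<rho>"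
    and graded: "graded_lie_algebra scale lie G"
    and W_submodule: "submodule W (ring_of_type_algebra :: 'k ring) (tensor_algebra scale)"
    and W_permute: "\<And>r \<sigma> t. \<sigma> permutes {..<r} \<Longrightarrow> t \<in> W \<Longrightarrow> tensor_permute scale r \<sigma> t \<in> W"
    and W_component: "\<And>ks t. t \<in> W \<Longrightarrow>
           component (tensor_algebra scale) (tensor_summand scale G) ks t \<in> W"
    and W_inj: "inj_on (envelope_map scale lie) W"
    and I_finite: "finite I"
    and orders: "\<And>i. i \<in> I \<Longrightarrow> a i \<noteq> []"
    and P_eq: "P = (\<Oplus>\<^bsub>tensor_algebra scale\<^esub>i\<in>I. pure_tensor scale (a i))"
    and P_in_W: "P \<in> W"
    and P_in_lie: "envelope_map scale lie P \<in> range (lie_embedding scale lie)"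
  shows "envelope_map scale lie (tensor_w scale G P) =
    (\<Oplus>\<^bsub>envelope scale lie\<^esub>i\<in>I.
       lie_embedding scale lie (left_comm lie (butlast (a i) @ [lie_w scale G (last (a i))])))"
  using graded_lie_algebra.envelope_map_tensor_w[OF graded I_finite orders P_eq P_in_lie] .

end
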